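(* Let $(R,\mathfrak m)$ be a $2$-dimensional Cohen-Macaulay local ring with infinite residue field. Let $\mathcal F=\{I_n\}_{n\ge 0}$ be a Hilbert filtration, $K$ an ideal with $I_1\subseteq K$ and $I_{n+1}\subseteq KI_n$ for all $n\ge 0$, and $J=(x,y)$ a minimal reduction of $I_1$. Then for all $n\ge2$, $$\Delta^2\left[P_K(\mathcal F,n)-H_K(\mathcal F,n)\right]=\lambda\left(\frac{KI_n}{KJI_{n-1}}\right)-\lambda\left(\frac{KI_{n-1}:J}{KI_{n-2}}\right).$$
   Context: Conventions: $\lambda$ denotes length. A filtration $\mathcal F=\{I_n\}_{n\ge0}$ of a Noetherian local ring $R$ is a sequence of ideals with $I_0=R$, $I_1\ne R$, $I_{n+1}\subseteq I_n$ and $I_nI_m\subseteq I_{n+m}$ for all $n,m\ge 0$. All filtrations are assumed Noetherian (the Rees algebra $\mathcal R(\mathcal F)=\bigoplus_{n\ge0}I_nt^n$ is a Noetherian ring) with $I_n\ne0$ for all $n$. $\mathcal F$ is $I_1$-good if $\mathcal R(\mathcal F)$ is a finite module over the Rees algebra $\mathcal R(I_1)=\bigoplus_{n\ge 0} I_1^nt^n$; an $I_1$-good filtration is a Hilbert filtration if $I_1$ is $\mathfrak m$-primary. $H_K(\mathcal F,n)=\lambda(R/KI_n)$, and $P_K(\mathcal F,n)$ is the polynomial in $n$ that agrees with $H_K(\mathcal F,n)$ for $n\gg0$. For a numerical function $h$, $\Delta h(n)=h(n)-h(n-1)$, so $\Delta^2h(n)=h(n)-2h(n-1)+h(n-2)$.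 *)

theory Defs
  imports
    "HOL-Library.Extended_Nat"
    "HOL-Computational_Algebra.Polynomial"
    "HOL-Algebra.QuotRing"
    "HOL-Algebra.Ideal_Product"
    "HOL-Algebra.Ring_Divisibility"
    "HOL-Algebra.UnivPoly"
begin

section \<open>Modules: quotients, length, finite generation\<close>

text \<open>
  The ring \<open>S\<close> with scalar multiplication given by its own product. This is a module over every
  subring of \<open>S\<close>, and the ideals of \<open>S\<close> are its submodules when the scalars are \<open>S\<close> itself.
\<close>

definition ring_as_module :: "('a, 'b) ring_scheme \<Rightarrow> ('a, 'a) module" where
  "ring_as_module S =
    \<lparr>carrier = carrier S, mult = mult S, one = one S, zero = zero S, add = add S,
     smult = mult S\<rparr>"

text \<open>
  The fields \<open>mult\<close> and \<open>one\<close> are part of every module record but play no role for a module,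
  so they are left unspecified.
\<close>

definition quot_module :: "('r, 'a, 'b) module_scheme \<Rightarrow> 'a set \<Rightarrow> ('r, 'a set) module" where
  "quot_module M N =
    \<lparr>carrier = a_rcosets\<^bsub>M\<^esub> N, mult = undefined, one = undefined, zero = N, add = set_add M,
     smult = (\<lambda>r X. \<Union>x\<in>X. N +>\<^bsub>M\<^esub> (r \<odot>\<^bsub>M\<^esub> x))\<rparr>"

lemma quot_module_is_module:
  assumes M: "module R M" and N: "submodule N R M"
  shows "module R (quot_module M N)"
proof -
  interpret module R M by fact
  interpret S: submodule N R M by fact
  have addN: "additive_subgroup N M"
    by (rule additive_subgroup.intro) (rule S.subgroup_axioms)
  interpret A: abelian_subgroup N M
    by (rule abelian_subgroupI3) (use addN abelian_group_axioms in auto)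
  have sm: "(\<Union>x\<in>N +>\<^bsub>M\<^esub> a. N +>\<^bsub>M\<^esub> (r \<odot>\<^bsub>M\<^esub> x)) = N +>\<^bsub>M\<^esub> (r \<odot>\<^bsub>M\<^esub> a)"
    if a: "a \<in> carrier M" and r: "r \<in> carrier R" for a r
  proof -
    have "N +>\<^bsub>M\<^esub> (r \<odot>\<^bsub>M\<^esub> x) = N +>\<^bsub>M\<^esub> (r \<odot>\<^bsub>M\<^esub> a)" if x: "x \<in> N +>\<^bsub>M\<^esub> a" for x
    proof -
      obtain k where k: "k \<in> N" "x = k \<oplus>\<^bsub>M\<^esub> a"
        using x by (auto simp: a_r_coset_def')
      have "k \<in> carrier M" using k A.a_subset by auto
      then have "r \<odot>\<^bsub>M\<^esub> x = r \<odot>\<^bsub>M\<^esub> k \<oplus>\<^bsub>M\<^esub> r \<odot>\<^bsub>M\<^esub> a"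
        using k a r by (simp add: smult_r_distr)
      moreover have "r \<odot>\<^bsub>M\<^esub> k \<in> N" using k r by auto
      ultimately have "r \<odot>\<^bsub>M\<^esub> x \<in> N +>\<^bsub>M\<^esub> (r \<odot>\<^bsub>M\<^esub> a)"
        by (auto simp: a_r_coset_def')
      then show ?thesis
        using A.a_repr_independence' a r by simp
    qed
    moreover have "a \<in> N +>\<^bsub>M\<^esub> a" using a A.a_rcos_self by auto
    ultimately show ?thesis by blast
  qed
  have cos: "\<exists>a\<in>carrier M. X = N +>\<^bsub>M\<^esub> a" if "X \<in> a_rcosets\<^bsub>M\<^esub> N" for X
    using that by (auto simp: A_RCOSETS_def')
  have cosI: "N +>\<^bsub>M\<^esub> a \<in> a_rcosets\<^bsub>M\<^esub> N" if "a \<in> carrier M" for a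
    using that by (auto simp: A_RCOSETS_def')
  have ag: "abelian_group (quot_module M N)"
  proof -
    interpret Q: comm_group "M A_Mod N" by (rule A.a_factorgroup_is_comm_group)
    have eqs: "carrier (quot_module M N) = carrier (M A_Mod N)"
      "add (quot_module M N) = monoid.mult (M A_Mod N)"
      "zero (quot_module M N) = one (M A_Mod N)"
      by (simp_all add: A_FactGroup_def' quot_module_def)
    show ?thesis
      by (rule abelian_groupI, unfold eqs) ((rule Q.m_closed Q.one_closed Q.m_assoc Q.m_comm Q.l_one Q.l_inv_ex; assumption)+)
  qed
  show ?thesis
  proof (rule moduleI[OF is_cring ag], goal_cases)
    case (1 a x)
    then show ?case using cos[of x] by (auto simp: quot_module_def sm intro!: cosI)
  next
    case (2 a b x)
    then obtain u where u: "u \<in> carrier M" "x = N +>\<^bsub>M\<^esub> u"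
      using cos[of x] by (auto simp: quot_module_def)
    show ?case
      using sm[OF u(1), of "a \<oplus>\<^bsub>R\<^esub> b"] 2 u
      by (simp add: quot_module_def sm A.a_rcos_sum smult_l_distr)
  next
    case (3 a x y)
    then obtain u v where u: "u \<in> carrier M" "x = N +>\<^bsub>M\<^esub> u"
      and v: "v \<in> carrier M" "y = N +>\<^bsub>M\<^esub> v"
      using cos[of x] cos[of y] by (auto simp: quot_module_def)
    show ?case
      using sm[of "u \<oplus>\<^bsub>M\<^esub> v" a] 3 u v
      by (simp add: quot_module_def sm A.a_rcos_sum smult_r_distr)
  next
    case (4 a b x)
    then obtain u where u: "u \<in> carrier M" "x = N +>\<^bsub>M\<^esub> u"
      using cos[of x] by (auto simp: quot_module_def)
    show ?case
      using sm[OF u(1), of "a \<otimes>\<^bsub>R\<^esub> b"] sm[of "b \<odot>\<^bsub>M\<^esub> u" a] sm[OF u(1), of b] 4 u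
      by (simp add: quot_module_def smult_assoc1)
  next
    case (5 x)
    then obtain u where u: "u \<in> carrier M" "x = N +>\<^bsub>M\<^esub> u"
      using cos[of x] by (auto simp: quot_module_def)
    show ?case
      using sm[OF u(1), of "\<one>\<^bsub>R\<^esub>"] u by (simp add: quot_module_def)
  qed
qed

definition module_length ::
    "('a, 'b) ring_scheme \<Rightarrow> ('a, 'c, 'd) module_scheme \<Rightarrow> enat" where
  "module_length R M =
    Sup {enat k | k. \<exists>C :: nat \<Rightarrow> 'c set.
      C 0 = {\<zero>\<^bsub>M\<^esub>} \<and> C k = carrier M \<and>
      (\<forall>i\<le>k. submodule (C i) R M) \<and> (\<forall>i<k. C i \<subset> C (Suc i))}"

definition fin_gen_module ::
    "('a, 'b) ring_scheme \<Rightarrow> ('a, 'c, 'd) module_scheme \<Rightarrow> bool" where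
  "fin_gen_module R M \<longleftrightarrow> module R M \<and>
    (\<exists>G. finite G \<and> G \<subseteq> carrier M \<and>
      (\<forall>N. submodule N R M \<and> G \<subseteq> N \<longrightarrow> N = carrier M))"

text \<open>
  The length of the \<open>R\<close>-module \<open>A/B\<close> for ideals \<open>B \<subseteq> A\<close> (possibly \<open>A = R\<close>), as a natural
  number. For infinite length the value is \<open>the_enat \<infinity>\<close>, which is unspecified.
\<close>

definition length_quot :: "('a, 'b) ring_scheme \<Rightarrow> 'a set \<Rightarrow> 'a set \<Rightarrow> nat" where
  "length_quot R A B =
    the_enat (module_length R (quot_module ((ring_as_module R)\<lparr>carrier := A\<rparr>) B))"


section \<open>Cohen-Macaulay local rings\<close>

definition noetherian_local_ring :: "('a, 'b) ring_scheme \<Rightarrow> 'a set \<Rightarrow> bool" where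
  "noetherian_local_ring R \<mm> \<longleftrightarrow> cring R \<and> noetherian_ring R \<and>
    maximalideal \<mm> R \<and> (\<forall>\<nn>. maximalideal \<nn> R \<longrightarrow> \<nn> = \<mm>)"

definition krull_dim :: "('a, 'b) ring_scheme \<Rightarrow> enat" where
  "krull_dim R =
    Sup {enat k | k. \<exists>P :: nat \<Rightarrow> 'a set.
      (\<forall>i\<le>k. primeideal (P i) R) \<and> (\<forall>i<k. P i \<subset> P (Suc i))}"

definition regular_sequence :: "('a, 'b) ring_scheme \<Rightarrow> 'a list \<Rightarrow> bool" where
  "regular_sequence R xs \<longleftrightarrow> set xs \<subseteq> carrier R \<and> genideal R (set xs) \<noteq> carrier R \<and>
    (\<forall>i<length xs. \<forall>a\<in>carrier R.
      a \<otimes>\<^bsub>R\<^esub> xs ! i \<in> genideal R (set (take i xs)) \<longrightarrow> a \<in> genideal R (set (take i xs)))"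

definition depth :: "('a, 'b) ring_scheme \<Rightarrow> 'a set \<Rightarrow> enat" where
  "depth R \<mm> = Sup {enat (length xs) | xs. regular_sequence R xs \<and> set xs \<subseteq> \<mm>}"

definition cohen_macaulay_local_ring :: "('a, 'b) ring_scheme \<Rightarrow> 'a set \<Rightarrow> bool" where
  "cohen_macaulay_local_ring R \<mm> \<longleftrightarrow>
    noetherian_local_ring R \<mm> \<and> depth R \<mm> = krull_dim R"


section \<open>Ideals\<close>

definition ideal_pow :: "('a, 'b) ring_scheme \<Rightarrow> 'a set \<Rightarrow> nat \<Rightarrow> 'a set" where
  "ideal_pow R I n = I [^]\<^bsub>ideals_set R\<^esub> n"

definition colon :: "('a, 'b) ring_scheme \<Rightarrow> 'a set \<Rightarrow> 'a set \<Rightarrow> 'a set" where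
  "colon R A B = {r \<in> carrier R. \<forall>b\<in>B. r \<otimes>\<^bsub>R\<^esub> b \<in> A}"

definition radical :: "('a, 'b) ring_scheme \<Rightarrow> 'a set \<Rightarrow> 'a set" where
  "radical R I = {r \<in> carrier R. \<exists>k::nat. r [^]\<^bsub>R\<^esub> k \<in> I}"

definition primary_ideal :: "('a, 'b) ring_scheme \<Rightarrow> 'a set \<Rightarrow> bool" where
  "primary_ideal R Q \<longleftrightarrow> ideal Q R \<and> Q \<noteq> carrier R \<and>
    (\<forall>a\<in>carrier R. \<forall>b\<in>carrier R. a \<otimes>\<^bsub>R\<^esub> b \<in> Q \<longrightarrow> a \<in> Q \<or> b \<in> radical R Q)"

definition is_reduction :: "('a, 'b) ring_scheme \<Rightarrow> 'a set \<Rightarrow> 'a set \<Rightarrow> bool" where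
  "is_reduction R J I \<longleftrightarrow> ideal J R \<and> J \<subseteq> I \<and>
    (\<exists>k. J \<cdot>\<^bsub>R\<^esub> ideal_pow R I k = ideal_pow R I (Suc k))"

definition is_minimal_reduction :: "('a, 'b) ring_scheme \<Rightarrow> 'a set \<Rightarrow> 'a set \<Rightarrow> bool" where
  "is_minimal_reduction R J I \<longleftrightarrow> is_reduction R J I \<and>
    (\<forall>J'. is_reduction R J' I \<and> J' \<subseteq> J \<longrightarrow> J' = J)"


section \<open>Filtrations\<close>

definition filtration :: "('a, 'b) ring_scheme \<Rightarrow> (nat \<Rightarrow> 'a set) \<Rightarrow> bool" where
  "filtration R F \<longleftrightarrow> (\<forall>n. ideal (F n) R) \<and> F 0 = carrier R \<and> F 1 \<noteq> carrier R \<and>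
    (\<forall>n. F (Suc n) \<subseteq> F n) \<and> (\<forall>n m. F n \<cdot>\<^bsub>R\<^esub> F m \<subseteq> F (n + m))"

text \<open>
  The Rees algebra \<open>\<Oplus>\<^sub>n F\<^sub>n t\<^sup>n\<close>, realised as the subring of the polynomial ring \<open>R[t]\<close> of all
  polynomials whose \<open>n\<close>-th coefficient lies in \<open>F\<^sub>n\<close>.
\<close>

definition rees_algebra ::
    "('a, 'b) ring_scheme \<Rightarrow> (nat \<Rightarrow> 'a set) \<Rightarrow> ('a, nat \<Rightarrow> 'a) up_ring" where
  "rees_algebra R F =
    (UP R)\<lparr>carrier := {p \<in> carrier (UP R). \<forall>n. UnivPoly.coeff (UP R) p n \<in> F n}\<rparr>"

definition noetherian_filtration :: "('a, 'b) ring_scheme \<Rightarrow> (nat \<Rightarrow> 'a set) \<Rightarrow> bool" where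
  "noetherian_filtration R F \<longleftrightarrow> filtration R F \<and> noetherian_ring (rees_algebra R F)"

definition good_filtration :: "('a, 'b) ring_scheme \<Rightarrow> (nat \<Rightarrow> 'a set) \<Rightarrow> bool" where
  "good_filtration R F \<longleftrightarrow> noetherian_filtration R F \<and> (\<forall>n. F n \<noteq> {\<zero>\<^bsub>R\<^esub>}) \<and>
    fin_gen_module (rees_algebra R (ideal_pow R (F 1))) (ring_as_module (rees_algebra R F))"

definition hilbert_filtration ::
    "('a, 'b) ring_scheme \<Rightarrow> 'a set \<Rightarrow> (nat \<Rightarrow> 'a set) \<Rightarrow> bool" where
  "hilbert_filtration R \<mm> F \<longleftrightarrow> good_filtration R F \<and>
    primary_ideal R (F 1) \<and> radical R (F 1) = \<mm>"


section \<open>Hilbert function and Hilbert polynomial\<close>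

definition hilbert_fun ::
    "('a, 'b) ring_scheme \<Rightarrow> 'a set \<Rightarrow> (nat \<Rightarrow> 'a set) \<Rightarrow> nat \<Rightarrow> nat" where
  "hilbert_fun R K F n = length_quot R (carrier R) (K \<cdot>\<^bsub>R\<^esub> F n)"

definition hilbert_poly ::
    "('a, 'b) ring_scheme \<Rightarrow> 'a set \<Rightarrow> (nat \<Rightarrow> 'a set) \<Rightarrow> rat poly" where
  "hilbert_poly R K F =
    (THE P. \<forall>\<^sub>F n in sequentially. poly P (of_nat n) = of_nat (hilbert_fun R K F n))"

text \<open>At \<open>n = 0\<close> the subtraction truncates; the value there is not meaningful.\<close>

definition back_diff :: "(nat \<Rightarrow> rat) \<Rightarrow> nat \<Rightarrow> rat" where
  "back_diff h n = h n - h (n - 1)"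

end

theory Submission
  imports Defs
begin

text \<open>
  Put \<open>A\<^sub>n = K I\<^sub>n\<close> and \<open>H(n) = \<lambda>(R/A\<^sub>n)\<close>. The proof combines an identity that holds in every degree with a
  vanishing statement in large degrees.

  The identity is the length formula
  \<open>\<lambda>(R/JA) + \<lambda>(R/(A : J)) = \<lambda>(R/J) + 2 \<lambda>(R/A)\<close>
  for an ideal \<open>A\<close> such that \<open>R/JA\<close> has finite length (\<open>length_two_gen_prod\<close>). It depends only on the
  syzygies of the two generators of \<open>J\<close> being the obvious ones, and they are because \<open>J\<close> contains powers
  of the members of a regular sequence of length two (\<open>trivial_syzygies_of_regular_sequence\<close>). Apply it to
  \<open>A = A\<^sub>n\<^sub>-\<^sub>1\<close> and use \<open>J A\<^sub>n\<^sub>-\<^sub>1 \<subseteq> A\<^sub>n\<close> and \<open>A\<^sub>n\<^sub>-\<^sub>2 \<subseteq> (A\<^sub>n\<^sub>-\<^sub>1 : J)\<close> to get, for all \<open>n \<ge> 2\<close>,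
  \<open>\<Delta>\<^sup>2 H(n) = \<lambda>(R/J) - \<lambda>(A\<^sub>n/J A\<^sub>n\<^sub>-\<^sub>1) + \<lambda>((A\<^sub>n\<^sub>-\<^sub>1 : J)/A\<^sub>n\<^sub>-\<^sub>2)\<close>.

  Both correction terms vanish for large \<open>n\<close>. For the first, \<open>I\<^sub>n = J I\<^sub>n\<^sub>-\<^sub>1\<close> for large \<open>n\<close>, since the Rees algebra
  of the filtration is finite over that of \<open>I\<^sub>1\<close> and \<open>J\<close> is a reduction of \<open>I\<^sub>1\<close>
  (\<open>good_filtration_eventually_reduction\<close>). For the second, \<open>(A\<^sub>n : J) = A\<^sub>n\<^sub>-\<^sub>1\<close> for large \<open>n\<close>, since ideals of the
  Rees algebra are generated in bounded degree and \<open>J\<close> contains a nonzerodivisor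
  (\<open>colon_eventually_shift\<close>).

  Hence \<open>\<Delta>\<^sup>2 H\<close> is eventually the constant \<open>\<lambda>(R/J)\<close>. So \<open>H\<close> agrees eventually with a polynomial, which is
  then \<open>P\<^sub>K\<close> by uniqueness, and \<open>\<Delta>\<^sup>2 P\<^sub>K = \<lambda>(R/J)\<close> everywhere (\<open>second_difference_eventual_poly\<close>).
  Subtracting the identity for \<open>\<Delta>\<^sup>2 H(n)\<close> gives the theorem.

  Lengths are computed as lengths of chains of ideals of \<open>R\<close>; every isomorphism of quotients needed is
  induced by multiplication by a single ring element (\<open>length_quot_mult\<close>).
\<close>

section \<open>Chains and their lengths\<close>

definition strict_chain :: "('a set \<Rightarrow> bool) \<Rightarrow> 'a set \<Rightarrow> 'a set \<Rightarrow> nat \<Rightarrow> bool" where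
  "strict_chain P B A k \<longleftrightarrow>
    (\<exists>C. C 0 = B \<and> C k = A \<and> (\<forall>i\<le>k. P (C i)) \<and> (\<forall>i<k. C i \<subset> C (Suc i)))"

lemma strict_chain_0_iff: "strict_chain P B A 0 \<longleftrightarrow> B = A \<and> P B"
  unfolding strict_chain_def by auto

lemma strict_chain_Suc_iff:
  "strict_chain P B A (Suc k) \<longleftrightarrow> (\<exists>M. strict_chain P B M k \<and> M \<subset> A \<and> P A)"
proof
  assume "strict_chain P B A (Suc k)"
  then obtain C where C: "C 0 = B" "C (Suc k) = A" "\<forall>i\<le>Suc k. P (C i)"
      "\<forall>i<Suc k. C i \<subset> C (Suc i)"
    unfolding strict_chain_def by blast
  have "strict_chain P B (C k) k"
    unfolding strict_chain_def using C by (intro exI[of _ C]) auto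
  then show "\<exists>M. strict_chain P B M k \<and> M \<subset> A \<and> P A"
    using C by (metis le_refl lessI)
next
  assume "\<exists>M. strict_chain P B M k \<and> M \<subset> A \<and> P A"
  then obtain M C where C: "C 0 = B" "C k = M" "\<forall>i\<le>k. P (C i)" "\<forall>i<k. C i \<subset> C (Suc i)"
      "M \<subset> A" "P A"
    unfolding strict_chain_def by blast
  show "strict_chain P B A (Suc k)"
    unfolding strict_chain_def
    by (rule exI[of _ "C(Suc k := A)"]) (use C in \<open>auto simp: less_Suc_eq le_Suc_eq\<close>)
qed

lemma strict_chain_subset: "strict_chain P B A k \<Longrightarrow> B \<subseteq> A"
  by (induction k arbitrary: A) (auto simp: strict_chain_0_iff strict_chain_Suc_iff)

lemma strict_chain_ends:
  assumes "strict_chain P B A k"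
  shows "P B" "P A"
  using assms unfolding strict_chain_def by auto

lemma strict_chain_trans:
  assumes "strict_chain P B M i" "strict_chain P M A j"
  shows "strict_chain P B A (i + j)"
  using assms(2)
  by (induction j arbitrary: A) (use assms(1) in \<open>auto simp: strict_chain_0_iff strict_chain_Suc_iff\<close>)

lemma strict_chain_exists:
  assumes "P B" "P A" "B \<subseteq> A"
  obtains j where "strict_chain P B A j"
proof (cases "B = A")
  case True
  then show ?thesis using that[of 0] assms by (simp add: strict_chain_0_iff)
next
  case False
  then have "strict_chain P B A (Suc 0)"
    unfolding strict_chain_Suc_iff strict_chain_0_iff using assms by blast
  then show ?thesis using that by blast
qed

text \<open>
  The form in which chains are transported: it covers both the passage to a quotient module and
  multiplication by a ring element, where the maps are injective only on the interval in question.
\<close>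
lemma strict_chain_map:
  assumes "strict_chain P B A k"
    and "\<And>X. P X \<Longrightarrow> B \<subseteq> X \<Longrightarrow> X \<subseteq> A \<Longrightarrow> Q (f X)"
    and "\<And>X Y. P X \<Longrightarrow> P Y \<Longrightarrow> B \<subseteq> X \<Longrightarrow> X \<subset> Y \<Longrightarrow> Y \<subseteq> A \<Longrightarrow> f X \<subset> f Y"
  shows "strict_chain Q (f B) (f A) k"
  using assms
proof (induction k arbitrary: A)
  case 0
  then show ?case by (auto simp: strict_chain_0_iff)
next
  case (Suc k)
  then obtain M where M: "strict_chain P B M k" "M \<subset> A" "P A"
    unfolding strict_chain_Suc_iff by blast
  have "P M" using M(1) strict_chain_ends by blast
  note BM = strict_chain_subset[OF M(1)]
  have "strict_chain Q (f B) (f M) k"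
  proof (rule Suc.IH[OF M(1)])
    show "Q (f X)" if "P X" "B \<subseteq> X" "X \<subseteq> M" for X
      using Suc.prems(2)[of X] that M by blast
    show "f X \<subset> f Y" if "P X" "P Y" "B \<subseteq> X" "X \<subset> Y" "Y \<subseteq> M" for X Y
      using Suc.prems(3)[of X Y] that M by blast
  qed
  moreover have "f M \<subset> f A" using Suc.prems(3)[of M A] M BM \<open>P M\<close> by blast
  moreover have "Q (f A)" using Suc.prems(2)[of A] M BM by blast
  ultimately show ?case unfolding strict_chain_Suc_iff by blast
qed

definition chain_length :: "('a set \<Rightarrow> bool) \<Rightarrow> 'a set \<Rightarrow> 'a set \<Rightarrow> nat \<Rightarrow> bool" where
  "chain_length P B A k \<longleftrightarrow> strict_chain P B A k \<and> (\<forall>j. strict_chain P B A j \<longrightarrow> j \<le> k)"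

text \<open>
  Lengths agree along an isomorphism of intervals. Monotonicity is asked for on all sets because the
  maps used below are given by formulas that are monotone without any restriction.
\<close>
lemma chain_length_iso:
  assumes "chain_length P B A k"
    and PQ: "\<And>X. P X \<Longrightarrow> B \<subseteq> X \<Longrightarrow> X \<subseteq> A \<Longrightarrow> Q (f X) \<and> g (f X) = X"
    and QP: "\<And>Y. Q Y \<Longrightarrow> f B \<subseteq> Y \<Longrightarrow> Y \<subseteq> f A \<Longrightarrow> P (g Y) \<and> f (g Y) = Y"
    and mono: "\<And>X Y. X \<subseteq> Y \<Longrightarrow> f X \<subseteq> f Y" "\<And>X Y. X \<subseteq> Y \<Longrightarrow> g X \<subseteq> g Y"
  shows "chain_length Q (f B) (f A) k"
proof -
  have ch: "strict_chain P B A k" using assms(1) by (simp add: chain_length_def)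
  note PBA = strict_chain_ends[OF ch] strict_chain_subset[OF ch]
  have gf: "g (f B) = B" "g (f A) = A" using PQ PBA by auto
  have "strict_chain Q (f B) (f A) k"
  proof (rule strict_chain_map[where P = P])
    show "strict_chain P B A k" using assms(1) by (simp add: chain_length_def)
    show "f X \<subset> f Y" if "P X" "P Y" "B \<subseteq> X" "X \<subset> Y" "Y \<subseteq> A" for X Y
    proof -
      have "g (f X) = X" "g (f Y) = Y" using PQ[of X] PQ[of Y] that by auto
      then have "f X \<noteq> f Y" using that(4) by (metis psubset_eq)
      then show ?thesis using mono(1)[of X Y] that by blast
    qed
  qed (use PQ in blast)
  moreover have "j \<le> k" if "strict_chain Q (f B) (f A) j" for j
  proof -
    have "strict_chain P (g (f B)) (g (f A)) j"
    proof (rule strict_chain_map[OF that])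
      show "g X \<subset> g Y" if "Q X" "Q Y" "f B \<subseteq> X" "X \<subset> Y" "Y \<subseteq> f A" for X Y
      proof -
        have "f (g X) = X" "f (g Y) = Y" using QP[of X] QP[of Y] that by auto
        then have "g X \<noteq> g Y" using that(4) by (metis psubset_eq)
        then show ?thesis using mono(2)[of X Y] that by blast
      qed
    qed (use QP in blast)
    then show ?thesis using assms(1) gf unfolding chain_length_def by simp
  qed
  ultimately show ?thesis unfolding chain_length_def by blast
qed

lemma Sup_chain_length:
  assumes "chain_length P B A k"
  shows "Sup {enat k | k. strict_chain P B A k} = enat k"
  by (rule Sup_eqI) (use assms in \<open>auto simp: chain_length_def\<close>)

abbreviation ideal_chain_length ::
    "('a, 'b) ring_scheme \<Rightarrow> 'a set \<Rightarrow> 'a set \<Rightarrow> nat \<Rightarrow> bool" where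
  "ideal_chain_length R \<equiv> chain_length (\<lambda>I. ideal I R)"

text \<open>
  Zero and negatives are scalar multiples, so a nonempty set closed under sums and scalars is a
  submodule.
\<close>
lemma (in module) submodule_closedI:
  assumes H: "H \<subseteq> carrier M" "H \<noteq> {}"
    and add: "\<And>a b. a \<in> H \<Longrightarrow> b \<in> H \<Longrightarrow> a \<oplus>\<^bsub>M\<^esub> b \<in> H"
    and smult: "\<And>r a. r \<in> carrier R \<Longrightarrow> a \<in> H \<Longrightarrow> r \<odot>\<^bsub>M\<^esub> a \<in> H"
  shows "submodule H R M"
proof (rule submoduleI)
  show "\<zero>\<^bsub>M\<^esub> \<in> H"
    using H smult[OF R.zero_closed] by (metis all_not_in_conv smult_l_null subsetD)
  show "\<ominus>\<^bsub>M\<^esub> a \<in> H" if "a \<in> H" for a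
    using smult[of "\<ominus> \<one>" a] smult_l_minus[of \<one> a] that H by (simp add: subset_eq)
qed (use assms in auto)

context cring
begin

lemma ideal_subset_closedI:
  assumes "I \<subseteq> carrier R" "\<zero> \<in> I"
    and "\<And>a b. a \<in> I \<Longrightarrow> b \<in> I \<Longrightarrow> a \<oplus> b \<in> I"
    and "\<And>a r. a \<in> I \<Longrightarrow> r \<in> carrier R \<Longrightarrow> r \<otimes> a \<in> I"
  shows "ideal I R"
proof (rule idealI[OF ring_axioms])
  show "subgroup I (add_monoid R)"
  proof (rule add.subgroupI)
    show "\<ominus> a \<in> I" if "a \<in> I" for a
    proof -
      have "\<ominus> a = \<ominus> \<one> \<otimes> a" using that assms(1) by (simp add: l_minus subset_eq)
      then show ?thesis using that assms(4) by simp
    qed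
  qed (use assms in auto)
  show "r \<otimes> a \<in> I" if "a \<in> I" "r \<in> carrier R" for a r using that assms by blast
  show "a \<otimes> r \<in> I" if "a \<in> I" "r \<in> carrier R" for a r
    using that assms m_comm[of a r] by auto
qed

lemma idealD:
  assumes "ideal I R"
  shows "I \<subseteq> carrier R" "\<zero> \<in> I" "\<And>a b. a \<in> I \<Longrightarrow> b \<in> I \<Longrightarrow> a \<oplus> b \<in> I"
    "\<And>a r. a \<in> I \<Longrightarrow> r \<in> carrier R \<Longrightarrow> r \<otimes> a \<in> I"
    "\<And>a r. a \<in> I \<Longrightarrow> r \<in> carrier R \<Longrightarrow> a \<otimes> r \<in> I"
    "\<And>a. a \<in> I \<Longrightarrow> \<ominus> a \<in> I" "\<And>a. a \<in> I \<Longrightarrow> a \<in> carrier R"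
proof -
  interpret ideal I R by fact
  show "I \<subseteq> carrier R" "\<zero> \<in> I" "\<And>a b. a \<in> I \<Longrightarrow> b \<in> I \<Longrightarrow> a \<oplus> b \<in> I"
    "\<And>a r. a \<in> I \<Longrightarrow> r \<in> carrier R \<Longrightarrow> r \<otimes> a \<in> I"
    "\<And>a r. a \<in> I \<Longrightarrow> r \<in> carrier R \<Longrightarrow> a \<otimes> r \<in> I"
    "\<And>a. a \<in> I \<Longrightarrow> \<ominus> a \<in> I" "\<And>a. a \<in> I \<Longrightarrow> a \<in> carrier R"
    by (auto intro: I_l_closed I_r_closed a_subset[THEN subsetD])
qed

lemma module_ring_as_module:
  assumes "ideal A R"
  shows "module R ((ring_as_module R)\<lparr>carrier := A\<rparr>)"
proof -
  note A = idealD[OF assms]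
  show ?thesis
  proof (rule moduleI[OF is_cring])
    show "abelian_group ((ring_as_module R)\<lparr>carrier := A\<rparr>)"
    proof (rule abelian_groupI)
      show "\<exists>y\<in>carrier (ring_as_module R\<lparr>carrier := A\<rparr>).
            y \<oplus>\<^bsub>ring_as_module R\<lparr>carrier := A\<rparr>\<^esub> x = \<zero>\<^bsub>ring_as_module R\<lparr>carrier := A\<rparr>\<^esub>"
        if "x \<in> carrier (ring_as_module R\<lparr>carrier := A\<rparr>)" for x
        using that A by (auto simp: ring_as_module_def intro!: bexI[of _ "\<ominus> x"] l_neg)
    qed (use A in \<open>auto simp: ring_as_module_def a_assoc intro: a_comm\<close>)
  qed (use A in \<open>auto simp: ring_as_module_def l_distr r_distr m_assoc\<close>)
qed

lemma submodule_ring_as_module_iff: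
  assumes A: "ideal A R"
  shows "submodule N R ((ring_as_module R)\<lparr>carrier := A\<rparr>) \<longleftrightarrow> ideal N R \<and> N \<subseteq> A"
proof
  let ?M = "(ring_as_module R)\<lparr>carrier := A\<rparr>"
  interpret M: module R ?M by (rule module_ring_as_module[OF A])
  {
    assume N: "submodule N R ?M"
    note E = M.submoduleE[OF N]
    have NA: "N \<subseteq> A" using E(1) by (simp add: ring_as_module_def)
    moreover have "ideal N R"
    proof (rule ideal_subset_closedI)
      show "N \<subseteq> carrier R" using NA idealD[OF A] by blast
      show cl: "r \<otimes> a \<in> N" if "a \<in> N" "r \<in> carrier R" for a r
        using E(4)[OF that(2,1)] by (simp add: ring_as_module_def)
      obtain a where "a \<in> N" using E(2) by blast
      then show "\<zero> \<in> N" using cl[of a \<zero>] NA idealD[OF A] by auto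
      show "a \<oplus> b \<in> N" if "a \<in> N" "b \<in> N" for a b
        using E(5)[OF that] by (simp add: ring_as_module_def)
    qed
    ultimately show "ideal N R \<and> N \<subseteq> A" by blast
  }
  {
    assume N: "ideal N R \<and> N \<subseteq> A"
    then have NA: "N \<subseteq> A" and Ni: "ideal N R" by auto
    note I = idealD[OF Ni]
    show "submodule N R ?M"
      by (rule M.submodule_closedI) (use I NA in \<open>auto simp: ring_as_module_def\<close>)
  }
qed


section \<open>Lengths of quotients of ideals\<close>

text \<open>
  The correspondence theorem: taking cosets and taking unions are inverse to each other between the
  ideals in \<open>[B, A]\<close> and the submodules of \<open>A/B\<close>. From here on lengths are counted with ideals of
  \<open>R\<close> only, and quotient modules do not occur again.
\<close>
lemma ideal_chain_length_quot:
  assumes A: "ideal A R" and B: "ideal B R" and "B \<subseteq> A" and k: "ideal_chain_length R B A k"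
  shows "length_quot R A B = k"
proof -
  define M where "M = (ring_as_module R)\<lparr>carrier := A\<rparr>"
  define Q where "Q = quot_module M B"
  define f where "f I = (\<lambda>a. B +>\<^bsub>M\<^esub> a) ` I" for I
  have Mmod: "module R M" unfolding M_def by (rule module_ring_as_module[OF A])
  interpret M: module R M by fact
  have M_simps: "carrier M = A" "add M = add R" "smult M = mult R" "zero M = zero R"
    by (simp_all add: M_def ring_as_module_def)
  have Bsub: "submodule B R M"
    using submodule_ring_as_module_iff[OF A] B \<open>B \<subseteq> A\<close> by (simp add: M_def)
  interpret S: submodule B R M by fact
  interpret B: abelian_subgroup B M
    by (rule abelian_subgroupI3[OF additive_subgroup.intro M.abelian_group_axioms])
      (rule S.subgroup_axioms)
  have "module R Q" unfolding Q_def by (rule quot_module_is_module[OF Mmod Bsub])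
  then interpret Q: module R Q .
  have Q_simps: "carrier Q = f A" "add Q = set_add M" "zero Q = B"
    "smult Q = (\<lambda>r X. \<Union>x\<in>X. B +>\<^bsub>M\<^esub> (r \<odot>\<^bsub>M\<^esub> x))"
    by (auto simp: Q_def quot_module_def A_RCOSETS_def' f_def M_simps)
  have coset_eq: "B +>\<^bsub>M\<^esub> x = B +>\<^bsub>M\<^esub> a" if "x \<in> B +>\<^bsub>M\<^esub> a" "a \<in> A" for a x
    using B.a_repr_independence'[of x a] that M_simps by simp
  have coset_self: "a \<in> B +>\<^bsub>M\<^esub> a" if "a \<in> A" for a
    using B.a_rcos_self[of a] that M_simps by simp
  have coset_mem: "x \<in> I" if "x \<in> B +>\<^bsub>M\<^esub> a" "a \<in> I" "ideal I R" "B \<subseteq> I" for x a I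
    using that idealD(3)[OF that(3)] by (auto simp: a_r_coset_def' M_simps)
  have coset_add: "(B +>\<^bsub>M\<^esub> a) \<oplus>\<^bsub>Q\<^esub> (B +>\<^bsub>M\<^esub> b) = B +>\<^bsub>M\<^esub> (a \<oplus> b)" if "a \<in> A" "b \<in> A" for a b
    using B.a_rcos_sum[of a b] that by (simp add: Q_simps M_simps)
  have coset_smult: "r \<odot>\<^bsub>Q\<^esub> (B +>\<^bsub>M\<^esub> a) = B +>\<^bsub>M\<^esub> (r \<otimes> a)"
    if r: "r \<in> carrier R" and a: "a \<in> A" for r a
  proof -
    have "B +>\<^bsub>M\<^esub> (r \<otimes> x) = B +>\<^bsub>M\<^esub> (r \<otimes> a)" if x: "x \<in> B +>\<^bsub>M\<^esub> a" for x
    proof (rule coset_eq)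
      obtain b where b: "b \<in> B" "x = b \<oplus> a" using x by (auto simp: a_r_coset_def' M_simps)
      have "r \<otimes> x = r \<otimes> b \<oplus> r \<otimes> a"
        using b r a idealD(7)[OF A] idealD(7)[OF B] by (simp add: r_distr)
      then show "r \<otimes> x \<in> B +>\<^bsub>M\<^esub> (r \<otimes> a)"
        using idealD(4)[OF B b(1) r] by (auto simp: a_r_coset_def' M_simps)
      show "r \<otimes> a \<in> A" using idealD(4)[OF A a r] .
    qed
    then have "r \<odot>\<^bsub>Q\<^esub> (B +>\<^bsub>M\<^esub> a) = (\<Union>x\<in>B +>\<^bsub>M\<^esub> a. B +>\<^bsub>M\<^esub> (r \<otimes> a))"
      unfolding Q_simps M_simps by (intro SUP_cong) auto
    then show ?thesis using coset_self[OF a] by auto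
  qed
  have "chain_length (\<lambda>X. submodule X R Q) (f B) (f A) k"
  proof (rule chain_length_iso[OF k, where g = Union])
    fix I assume I: "ideal I R" "B \<subseteq> I" "I \<subseteq> A"
    have "submodule (f I) R Q"
    proof (rule Q.submodule_closedI)
      show "f I \<subseteq> carrier Q" using I by (auto simp: Q_simps f_def)
      show "f I \<noteq> {}" using idealD(2)[OF I(1)] by (auto simp: f_def)
      show "X \<oplus>\<^bsub>Q\<^esub> Y \<in> f I" if "X \<in> f I" "Y \<in> f I" for X Y
      proof -
        obtain a b where ab: "a \<in> I" "b \<in> I" "X = B +>\<^bsub>M\<^esub> a" "Y = B +>\<^bsub>M\<^esub> b"
          using \<open>X \<in> f I\<close> \<open>Y \<in> f I\<close> unfolding f_def by blast
        then have "X \<oplus>\<^bsub>Q\<^esub> Y = B +>\<^bsub>M\<^esub> (a \<oplus> b)" using coset_add I by blast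
        then show ?thesis using idealD(3)[OF I(1)] ab by (auto simp: f_def)
      qed
      show "r \<odot>\<^bsub>Q\<^esub> X \<in> f I" if "r \<in> carrier R" "X \<in> f I" for r X
      proof -
        obtain a where a: "a \<in> I" "X = B +>\<^bsub>M\<^esub> a"
          using \<open>X \<in> f I\<close> unfolding f_def by blast
        then have "r \<odot>\<^bsub>Q\<^esub> X = B +>\<^bsub>M\<^esub> (r \<otimes> a)" using coset_smult that I by blast
        then show ?thesis using idealD(4)[OF I(1)] a that by (auto simp: f_def)
      qed
    qed
    moreover have "\<Union>(f I) = I"
    proof
      show "\<Union>(f I) \<subseteq> I" using coset_mem I by (auto simp: f_def)
      show "I \<subseteq> \<Union>(f I)" using coset_self I by (auto simp: f_def)
    qed
    ultimately show "submodule (f I) R Q \<and> \<Union>(f I) = I" ..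
  next
    fix X assume X: "submodule X R Q" "f B \<subseteq> X" "X \<subseteq> f A"
    note E = Q.submoduleE[OF X(1)]
    have cos: "\<exists>a\<in>A. Y = B +>\<^bsub>M\<^esub> a" if "Y \<in> X" for Y using that X by (auto simp: f_def)
    have UA: "\<Union>X \<subseteq> A"
      using cos coset_mem[OF _ _ A \<open>B \<subseteq> A\<close>] by blast
    have mem: "B +>\<^bsub>M\<^esub> a \<in> X \<and> a \<in> A" if "a \<in> \<Union>X" for a
    proof -
      obtain Y where Y: "Y \<in> X" "a \<in> Y" using \<open>a \<in> \<Union>X\<close> by blast
      then obtain c where c: "c \<in> A" "Y = B +>\<^bsub>M\<^esub> c" using cos by blast
      show ?thesis using coset_eq[of a c] Y c UA by auto
    qed
    have memI: "a \<in> \<Union>X" if "B +>\<^bsub>M\<^esub> a \<in> X" "a \<in> A" for a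
      using coset_self[OF that(2)] that(1) by blast
    have "ideal (\<Union>X) R"
    proof (rule ideal_subset_closedI)
      show "\<Union>X \<subseteq> carrier R" using UA idealD(1)[OF A] by blast
      have "B +>\<^bsub>M\<^esub> \<zero> \<in> X" using X(2) idealD(2)[OF B] by (auto simp: f_def)
      then show "\<zero> \<in> \<Union>X" using memI idealD(2)[OF A] by blast
      show "a \<oplus> b \<in> \<Union>X" if "a \<in> \<Union>X" "b \<in> \<Union>X" for a b
        using mem[OF that(1)] mem[OF that(2)] E(5)[of "B +>\<^bsub>M\<^esub> a" "B +>\<^bsub>M\<^esub> b"] coset_add[of a b]
          idealD(3)[OF A, of a b] by (intro memI) auto
      show "r \<otimes> a \<in> \<Union>X" if "a \<in> \<Union>X" "r \<in> carrier R" for r a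
        using mem[OF that(1)] E(4)[OF that(2), of "B +>\<^bsub>M\<^esub> a"] coset_smult[OF that(2), of a]
          idealD(4)[OF A, of a r] that(2) by (intro memI) auto
    qed
    moreover have "f (\<Union>X) = X"
    proof
      show "f (\<Union>X) \<subseteq> X" using mem by (auto simp: f_def)
      show "X \<subseteq> f (\<Union>X)"
      proof
        fix Y assume "Y \<in> X"
        then obtain c where c: "c \<in> A" "Y = B +>\<^bsub>M\<^esub> c" using cos by blast
        then show "Y \<in> f (\<Union>X)" using memI[of c] \<open>Y \<in> X\<close> by (auto simp: f_def)
      qed
    qed
    ultimately show "ideal (\<Union>X) R \<and> f (\<Union>X) = X" ..
  qed (auto simp: f_def)
  moreover have "f B = {\<zero>\<^bsub>Q\<^esub>}"
    using B.a_rcos_const idealD(2)[OF B] by (auto simp: f_def Q_simps)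
  ultimately have "module_length R Q = enat k"
    using Sup_chain_length[of "\<lambda>X. submodule X R Q" "f B" "f A" k]
    by (simp add: module_length_def Q_simps(1) strict_chain_def conj_assoc)
  then show ?thesis by (simp add: length_quot_def Q_def M_def)
qed

lemma set_add_mem:
  "z \<in> set_add R I J \<longleftrightarrow> (\<exists>a\<in>I. \<exists>b\<in>J. z = a \<oplus> b)"
  by (auto simp: set_add_def')

lemma set_add_absorb:
  assumes A: "ideal A R" and B: "ideal B R" and "B \<subseteq> A"
  shows "set_add R A B = A" "set_add R B A = A"
proof -
  show *: "set_add R A B = A"
  proof
    show "set_add R A B \<subseteq> A" using \<open>B \<subseteq> A\<close> by (auto simp: set_add_mem intro!: idealD(3)[OF A])
    show "A \<subseteq> set_add R A B"
    proof
      fix z assume z: "z \<in> A"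
      then have "z = z \<oplus> \<zero>" using idealD(7)[OF A] by simp
      then show "z \<in> set_add R A B" using z idealD(2)[OF B] unfolding set_add_mem by blast
    qed
  qed
  show "set_add R B A = A" using set_add_comm[OF idealD(1)[OF A] idealD(1)[OF B]] * by simp
qed

text \<open>
  The modular law, in the form that drives additivity: a proper inclusion of ideals stays proper after
  intersecting with \<open>M\<close> or after adding \<open>M\<close>.
\<close>
lemma ideals_modular:
  assumes "ideal A R" "ideal A' R" "ideal M R" "A \<subseteq> A'"
    and "A \<inter> M = A' \<inter> M" "set_add R A M = set_add R A' M"
  shows "A = A'"
proof
  show "A' \<subseteq> A"
  proof
    fix z assume z: "z \<in> A'"
    have "z \<oplus> \<zero> \<in> set_add R A' M" using z idealD(2)[OF assms(3)] unfolding set_add_mem by blast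
    then have "z \<in> set_add R A M" using z idealD(7)[OF assms(2)] assms(6) by simp
    then obtain a m where am: "a \<in> A" "m \<in> M" "z = a \<oplus> m" unfolding set_add_mem by blast
    have c: "a \<in> carrier R" "m \<in> carrier R" using am idealD(7)[OF assms(1)] idealD(7)[OF assms(3)] by auto
    have "m = \<ominus> a \<oplus> z" using am c by (simp add: r_neg1)
    moreover have "\<ominus> a \<oplus> z \<in> A'" using am z assms(4) idealD(3,6)[OF assms(2)] by auto
    ultimately have "m \<in> A" using am assms(5) by auto
    then show "z \<in> A" using am idealD(3)[OF assms(1)] by simp
  qed
qed fact

abbreviation "ideal_chain \<equiv> strict_chain (\<lambda>I. ideal I R)"

lemma ideal_chain_extend:
  assumes "ideal_chain B A k" "ideal A' R" "A \<subseteq> A'"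
  shows "\<exists>j\<le>Suc k. ideal_chain B A' j \<and> (A \<noteq> A' \<longrightarrow> j = Suc k) \<and> (A = A' \<longrightarrow> j = k)"
  using assms by (cases "A = A'") (auto simp: strict_chain_Suc_iff)

text \<open>
  Every strict step of a chain shows up in the chain of its intersections with \<open>M\<close> or in the chain of
  its sums with \<open>M\<close>, by the modular law. This is the Jordan--Hoelder argument reduced to the inequality
  that additivity of length requires.
\<close>
lemma ideal_chain_split_at:
  assumes "ideal_chain B A k" "ideal M R" "B \<subseteq> M"
  shows "\<exists>i j. ideal_chain B (A \<inter> M) i \<and> ideal_chain M (set_add R A M) j \<and> k \<le> i + j"
  using assms(1)
proof (induction k arbitrary: A)
  case 0
  then have [simp]: "A = B" and B: "ideal B R" by (auto simp: strict_chain_0_iff)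
  have "set_add R B M = M" by (rule set_add_absorb(2)[OF assms(2) B assms(3)])
  moreover have "B \<inter> M = B" using assms by blast
  ultimately have "ideal_chain B (A \<inter> M) 0 \<and> ideal_chain M (set_add R A M) 0"
    using B assms by (simp add: strict_chain_0_iff)
  then show ?case by fastforce
next
  case (Suc k)
  then obtain N where N: "ideal_chain B N k" "N \<subset> A" "ideal A R"
    unfolding strict_chain_Suc_iff by blast
  have iN: "ideal N R" using strict_chain_ends[OF N(1)] by blast
  obtain i j where ij: "ideal_chain B (N \<inter> M) i" "ideal_chain M (set_add R N M) j" "k \<le> i + j"
    using Suc.IH[OF N(1)] by blast
  have s: "N \<inter> M \<subseteq> A \<inter> M" "set_add R N M \<subseteq> set_add R A M" using N(2) by (auto simp: set_add_def')
  obtain i' where i': "ideal_chain B (A \<inter> M) i'" "N \<inter> M \<noteq> A \<inter> M \<longrightarrow> i' = Suc i"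
      "N \<inter> M = A \<inter> M \<longrightarrow> i' = i"
    using ideal_chain_extend[OF ij(1) i_intersect[OF N(3) assms(2)] s(1)] by blast
  obtain j' where j': "ideal_chain M (set_add R A M) j'" "set_add R N M \<noteq> set_add R A M \<longrightarrow> j' = Suc j"
      "set_add R N M = set_add R A M \<longrightarrow> j' = j"
    using ideal_chain_extend[OF ij(2) add_ideals[OF N(3) assms(2)] s(2)] by blast
  have "N \<inter> M \<noteq> A \<inter> M \<or> set_add R N M \<noteq> set_add R A M"
    using ideals_modular[OF iN N(3) assms(2)] N(2) by blast
  then have "Suc k \<le> i' + j'" using ij(3) i'(2,3) j'(2,3) by fastforce
  then show ?case using i'(1) j'(1) by blast
qed

definition fin_length :: "'a set \<Rightarrow> 'a set \<Rightarrow> bool" where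
  "fin_length A B \<longleftrightarrow> (\<exists>k. ideal_chain_length R B A k)"

lemma chain_length_imp_ideals:
  assumes "ideal_chain_length R B A k"
  shows "ideal B R" "ideal A R" "B \<subseteq> A"
proof -
  have c: "ideal_chain B A k" using assms unfolding chain_length_def by blast
  show "ideal B R" "ideal A R" "B \<subseteq> A" using strict_chain_ends[OF c] strict_chain_subset[OF c] .
qed

lemma fin_length_ideals:
  assumes "fin_length A B"
  shows "ideal B R" "ideal A R" "B \<subseteq> A"
  using assms chain_length_imp_ideals unfolding fin_length_def by blast+

lemma ideal_chain_length_eq:
  assumes "ideal_chain_length R B A k"
  shows "fin_length A B" "length_quot R A B = k"
  using assms ideal_chain_length_quot chain_length_imp_ideals[OF assms]
  unfolding fin_length_def by blast+

lemma ideal_chain_le_add: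
  assumes "ideal_chain B A k" "ideal M R" "B \<subseteq> M" "M \<subseteq> A"
  obtains i j where "ideal_chain B M i" "ideal_chain M A j" "k \<le> i + j"
proof -
  have iA: "ideal A R" using strict_chain_ends[OF assms(1)] by blast
  have "A \<inter> M = M" using assms by blast
  moreover have "set_add R A M = A" by (rule set_add_absorb(1)[OF iA assms(2,4)])
  ultimately show ?thesis using ideal_chain_split_at[OF assms(1-3)] that by auto
qed

lemma fin_length_trans:
  assumes "fin_length A M" "fin_length M B"
  shows "fin_length A B"
    and "length_quot R A B = length_quot R A M + length_quot R M B"
proof -
  obtain i j where ij: "ideal_chain_length R M A i" "ideal_chain_length R B M j"
    using assms unfolding fin_length_def by blast
  have "ideal_chain_length R B A (j + i)"
    unfolding chain_length_def
  proof safe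
    show "ideal_chain B A (j + i)"
      using ij strict_chain_trans unfolding chain_length_def by blast
    show "k \<le> j + i" if k: "ideal_chain B A k" for k
    proof -
      obtain j' i' where "ideal_chain B M j'" "ideal_chain M A i'" "k \<le> j' + i'"
        using ideal_chain_le_add[OF k, of M] chain_length_imp_ideals[OF ij(1)]
          chain_length_imp_ideals[OF ij(2)] by blast
      moreover have "j' \<le> j" "i' \<le> i" using calculation ij unfolding chain_length_def by blast+
      ultimately show ?thesis by linarith
    qed
  qed
  then show "fin_length A B" "length_quot R A B = length_quot R A M + length_quot R M B"
    using ideal_chain_length_eq ij by (metis, metis add.commute)
qed

lemma bounded_chain_length:
  assumes "ideal_chain B A i" "\<And>j. ideal_chain B A j \<Longrightarrow> j \<le> N"
  shows "fin_length A B"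
proof -
  define k where "k = (GREATEST j. ideal_chain B A j)"
  have "ideal_chain B A k" unfolding k_def by (rule GreatestI_nat) (use assms in auto)
  moreover have "j \<le> k" if "ideal_chain B A j" for j
    unfolding k_def by (rule Greatest_le_nat) (use assms that in auto)
  ultimately show ?thesis unfolding fin_length_def chain_length_def by blast
qed

lemma fin_length_split:
  assumes "fin_length A B" "ideal M R" "B \<subseteq> M" "M \<subseteq> A"
  shows "fin_length A M" "fin_length M B"
proof -
  obtain k where k: "\<And>j. ideal_chain B A j \<Longrightarrow> j \<le> k"
    using assms(1) unfolding fin_length_def chain_length_def by blast
  note I = fin_length_ideals[OF assms(1)]
  obtain p where p: "ideal_chain B M p" using strict_chain_exists[OF I(1) assms(2,3)] .
  obtain q where q: "ideal_chain M A q" using strict_chain_exists[OF assms(2) I(2) assms(4)] .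
  show "fin_length A M"
  proof (rule bounded_chain_length[OF q])
    show "j \<le> k" if "ideal_chain M A j" for j
      using k[OF strict_chain_trans[OF p that]] by simp
  qed
  show "fin_length M B"
  proof (rule bounded_chain_length[OF p])
    show "j \<le> k" if "ideal_chain B M j" for j
      using k[OF strict_chain_trans[OF that q]] by simp
  qed
qed

lemma length_quot_add:
  assumes "fin_length A B" "ideal M R" "B \<subseteq> M" "M \<subseteq> A"
  shows "length_quot R A B = length_quot R A M + length_quot R M B"
  using fin_length_trans(2) fin_length_split[OF assms] by blast

lemma length_quot_refl:
  assumes "ideal A R"
  shows "length_quot R A A = 0"
proof -
  have "j \<le> 0" if "ideal_chain A A j" for j
    using that by (cases j) (auto simp: strict_chain_Suc_iff dest: strict_chain_subset)
  then have "ideal_chain_length R A A 0"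
    unfolding chain_length_def using assms by (simp add: strict_chain_0_iff)
  then show ?thesis using ideal_chain_length_eq by blast
qed

section \<open>Multiplication by a ring element\<close>

text \<open>
  The ideal \<open>cL + B\<close>. Sums with a principal ideal are the case \<open>L = R\<close>; the product of a
  two-generated ideal with \<open>A\<close> arises by applying it twice with \<open>L = A\<close>.
\<close>
definition mult_plus :: "'a \<Rightarrow> 'a set \<Rightarrow> 'a set \<Rightarrow> 'a set" where
  "mult_plus c L B = {c \<otimes> l \<oplus> b | l b. l \<in> L \<and> b \<in> B}"

definition elem_colon :: "'a set \<Rightarrow> 'a \<Rightarrow> 'a set" where
  "elem_colon I c = {r \<in> carrier R. c \<otimes> r \<in> I}"

lemma mult_plusI: "l \<in> L \<Longrightarrow> b \<in> B \<Longrightarrow> z = c \<otimes> l \<oplus> b \<Longrightarrow> z \<in> mult_plus c L B"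
  unfolding mult_plus_def by blast

lemma mult_plusE:
  assumes "z \<in> mult_plus c L B" "ideal L R" "ideal B R"
  obtains l b where "z = c \<otimes> l \<oplus> b" "l \<in> L" "b \<in> B" "l \<in> carrier R" "b \<in> carrier R"
  using assms(1) idealD(7)[OF assms(2)] idealD(7)[OF assms(3)] unfolding mult_plus_def by blast

lemma mult_plus_ideal:
  assumes c: "c \<in> carrier R" and L: "ideal L R" and B: "ideal B R"
  shows "ideal (mult_plus c L B) R"
proof (rule ideal_subset_closedI)
  show "mult_plus c L B \<subseteq> carrier R" using c by (auto elim!: mult_plusE[OF _ L B])
  show "\<zero> \<in> mult_plus c L B"
    by (rule mult_plusI[OF idealD(2)[OF L] idealD(2)[OF B]]) (use c in simp)
  show "u \<oplus> v \<in> mult_plus c L B" if uv: "u \<in> mult_plus c L B" "v \<in> mult_plus c L B" for u v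
  proof -
    obtain l b where u: "u = c \<otimes> l \<oplus> b" "l \<in> L" "b \<in> B" "l \<in> carrier R" "b \<in> carrier R"
      by (rule mult_plusE[OF uv(1) L B])
    obtain l' b' where v: "v = c \<otimes> l' \<oplus> b'" "l' \<in> L" "b' \<in> B" "l' \<in> carrier R" "b' \<in> carrier R"
      by (rule mult_plusE[OF uv(2) L B])
    have "u \<oplus> v = c \<otimes> (l \<oplus> l') \<oplus> (b \<oplus> b')" unfolding u(1) v(1) using u v c by algebra
    then show ?thesis by (rule mult_plusI[OF idealD(3)[OF L u(2) v(2)] idealD(3)[OF B u(3) v(3)]])
  qed
  show "r \<otimes> u \<in> mult_plus c L B" if ur: "u \<in> mult_plus c L B" "r \<in> carrier R" for u r
  proof -
    obtain l b where u: "u = c \<otimes> l \<oplus> b" "l \<in> L" "b \<in> B" "l \<in> carrier R" "b \<in> carrier R"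
      by (rule mult_plusE[OF ur(1) L B])
    have "r \<otimes> u = c \<otimes> (r \<otimes> l) \<oplus> r \<otimes> b" unfolding u(1) using u c ur by algebra
    then show ?thesis by (rule mult_plusI[OF idealD(4)[OF L u(2) ur(2)] idealD(4)[OF B u(3) ur(2)]])
  qed
qed

lemma elem_colon_ideal:
  assumes "c \<in> carrier R" "ideal I R"
  shows "ideal (elem_colon I c) R"
  unfolding elem_colon_def by (rule ideal.helper_max_prime[OF assms(2) is_cring assms(1)])

lemma subset_mult_plus:
  assumes "c \<in> carrier R" "ideal L R" "ideal B R"
  shows "B \<subseteq> mult_plus c L B"
proof
  fix b assume "b \<in> B"
  then have "b = c \<otimes> \<zero> \<oplus> b" using assms(1) idealD(7)[OF assms(3)] by simp
  then show "b \<in> mult_plus c L B" using \<open>b \<in> B\<close> idealD(2)[OF assms(2)] by (intro mult_plusI)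
qed

lemma mult_plus_least:
  assumes "ideal M R" "B \<subseteq> M" "\<And>l. l \<in> L \<Longrightarrow> c \<otimes> l \<in> M"
  shows "mult_plus c L B \<subseteq> M"
  using assms idealD(3)[OF assms(1)] unfolding mult_plus_def by blast

text \<open>
  Multiplication by \<open>c\<close> induces an isomorphism from \<open>L/((B : c) \<inter> L)\<close> onto \<open>(cL + B)/B\<close>. It replaces
  every exact sequence needed below.
\<close>
lemma length_quot_mult:
  assumes c: "c \<in> carrier R" and L: "ideal L R" and B: "ideal B R"
    and fin: "fin_length L (elem_colon B c \<inter> L)"
  shows "fin_length (mult_plus c L B) B"
    and "length_quot R (mult_plus c L B) B = length_quot R L (elem_colon B c \<inter> L)"
proof -
  let ?D = "elem_colon B c \<inter> L"
  let ?f = "\<lambda>X. mult_plus c X B" and ?g = "\<lambda>Y. elem_colon Y c \<inter> L"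
  obtain k where k: "ideal_chain_length R ?D L k" using fin unfolding fin_length_def by blast
  have D: "ideal ?D R" by (rule i_intersect[OF elem_colon_ideal[OF c B] L])
  have fD: "?f ?D = B"
  proof
    show "?f ?D \<subseteq> B" by (rule mult_plus_least[OF B]) (auto simp: elem_colon_def)
    show "B \<subseteq> ?f ?D" by (rule subset_mult_plus[OF c D B])
  qed
  have "ideal_chain_length R (?f ?D) (?f L) k"
  proof (rule chain_length_iso[OF k, where g = ?g])
    fix X assume X: "ideal X R" "?D \<subseteq> X" "X \<subseteq> L"
    have "?g (?f X) = X"
    proof
      show "X \<subseteq> ?g (?f X)"
      proof
        fix a assume a: "a \<in> X"
        then have "a \<in> carrier R" using idealD(7)[OF X(1)] by blast
        moreover have "c \<otimes> a = c \<otimes> a \<oplus> \<zero>" using c calculation by simp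
        then have "c \<otimes> a \<in> ?f X" using a idealD(2)[OF B] unfolding mult_plus_def by blast
        ultimately show "a \<in> ?g (?f X)" using a X by (auto simp: elem_colon_def)
      qed
      show "?g (?f X) \<subseteq> X"
      proof
        fix a assume "a \<in> ?g (?f X)"
        then obtain l b where a: "a \<in> carrier R" "a \<in> L" "c \<otimes> a = c \<otimes> l \<oplus> b" "l \<in> X" "b \<in> B"
          by (auto simp: elem_colon_def mult_plus_def)
        have lb: "l \<in> carrier R" "b \<in> carrier R"
          using a idealD(7)[OF X(1)] idealD(7)[OF B] by auto
        have "c \<otimes> (a \<ominus> l) = c \<otimes> a \<ominus> c \<otimes> l" using a lb c by algebra
        also have "\<dots> = b" unfolding a(3) using lb c by algebra
        finally have "a \<ominus> l \<in> elem_colon B c" using a lb by (simp add: elem_colon_def)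
        moreover have "a \<ominus> l \<in> L"
          using a X idealD(3,6)[OF L] unfolding a_minus_def by auto
        ultimately have "a \<ominus> l \<in> X" using X by blast
        then have "(a \<ominus> l) \<oplus> l \<in> X" using a idealD(3)[OF X(1)] by blast
        moreover have "(a \<ominus> l) \<oplus> l = a" using a lb by algebra
        ultimately show "a \<in> X" by simp
      qed
    qed
    then show "ideal (?f X) R \<and> ?g (?f X) = X" using mult_plus_ideal[OF c X(1) B] by simp
  next
    fix Y assume Y: "ideal Y R" "?f ?D \<subseteq> Y" "Y \<subseteq> ?f L"
    have "?f (?g Y) = Y"
    proof
      show "?f (?g Y) \<subseteq> Y"
        by (rule mult_plus_least[OF Y(1)]) (use Y fD in \<open>auto simp: elem_colon_def\<close>)
      show "Y \<subseteq> ?f (?g Y)"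
      proof
        fix z assume z: "z \<in> Y"
        then obtain l b where lb: "l \<in> L" "b \<in> B" "z = c \<otimes> l \<oplus> b"
          using Y unfolding mult_plus_def by blast
        have cr: "l \<in> carrier R" "b \<in> carrier R"
          using lb idealD(7)[OF L] idealD(7)[OF B] by auto
        have "\<ominus> b \<oplus> z \<in> Y" using z lb(2) Y(2) fD idealD(3,6)[OF Y(1)] by auto
        moreover have "\<ominus> b \<oplus> z = c \<otimes> l" unfolding lb using cr c by algebra
        ultimately have "l \<in> ?g Y" using lb cr by (simp add: elem_colon_def)
        then show "z \<in> ?f (?g Y)" using lb unfolding mult_plus_def by blast
      qed
    qed
    then show "ideal (?g Y) R \<and> ?f (?g Y) = Y"
      using i_intersect[OF elem_colon_ideal[OF c Y(1)] L] by simp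
  qed (auto simp: mult_plus_def elem_colon_def)
  then show "fin_length (mult_plus c L B) B"
    and "length_quot R (mult_plus c L B) B = length_quot R L (elem_colon B c \<inter> L)"
    using ideal_chain_length_eq k unfolding fD by metis+
qed

end

section \<open>Ideals of finite colength\<close>

lemma (in noetherian_ring) exists_maximal_ideal_in:
  assumes "S \<noteq> {}" "\<And>I. I \<in> S \<Longrightarrow> ideal I R"
  obtains M where "M \<in> S" "\<And>I. I \<in> S \<Longrightarrow> M \<subseteq> I \<Longrightarrow> I = M"
proof -
  have "\<exists>M\<in>S. \<forall>X\<in>S. M \<subseteq> X \<longrightarrow> X = M"
  proof (rule subset_Zorn_nonempty[OF assms(1)])
    fix C assume C: "C \<noteq> {}" "subset.chain S C"
    have "subset.chain {I. ideal I R} C"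
      using C(2) assms(2) unfolding subset_chain_def by blast
    then show "\<Union>C \<in> S"
      using ideal_chain_is_trivial[OF C(1)] C(2) unfolding subset_chain_def by blast
  qed
  then show ?thesis using that by blast
qed

context cring
begin

lemma maximal_chain_length:
  assumes "maximalideal \<mm> R"
  shows "ideal_chain_length R \<mm> (carrier R) 1"
proof -
  interpret m: maximalideal \<mm> R by fact
  have "\<mm> \<subset> carrier R" using m.I_notcarr m.a_subset by blast
  then have "ideal_chain \<mm> (carrier R) (Suc 0)"
    unfolding strict_chain_Suc_iff strict_chain_0_iff using m.is_ideal oneideal by blast
  moreover have "j \<le> 1" if j: "ideal_chain \<mm> (carrier R) j" for j
  proof (rule ccontr)
    assume "\<not> j \<le> 1"
    then obtain i where "j = Suc (Suc i)" by (metis One_nat_def le_SucI not0_implies_Suc not_less_eq_eq zero_le)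
    then have "ideal_chain \<mm> (carrier R) (Suc (Suc i))" using j by simp
    then obtain M where M: "ideal_chain \<mm> M (Suc i)" "M \<subset> carrier R"
      unfolding strict_chain_Suc_iff[of _ _ _ "Suc i"] by blast
    obtain N where N: "ideal_chain \<mm> N i" "N \<subset> M" "ideal M R"
      using M(1) unfolding strict_chain_Suc_iff by blast
    have "\<mm> \<subset> M" using strict_chain_subset[OF N(1)] N(2) by blast
    then show False using m.I_maximal[OF N(3)] M(2) by blast
  qed
  ultimately show ?thesis unfolding chain_length_def by simp
qed

text \<open>
  A maximal counterexample \<open>M\<close> cannot exist. Among the ideals \<open>(M : c)\<close> with \<open>c \<notin> M\<close> a maximal one
  contains every element nilpotent modulo \<open>M\<close>, hence equals \<open>\<mm>\<close>. So \<open>M + cR\<close> lies just one step above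
  \<open>M\<close>, and \<open>R/(M + cR)\<close> has finite length by the choice of \<open>M\<close>.
\<close>
lemma fin_length_radical:
  assumes noeth: "noetherian_ring R" and max: "maximalideal \<mm> R"
    and Q: "ideal Q R" "\<mm> \<subseteq> radical R Q"
  shows "fin_length (carrier R) Q"
proof (rule ccontr)
  interpret noetherian_ring R by fact
  interpret m: maximalideal \<mm> R by fact
  assume nf: "\<not> fin_length (carrier R) Q"
  define S where "S = {I. ideal I R \<and> \<mm> \<subseteq> radical R I \<and> \<not> fin_length (carrier R) I}"
  have "Q \<in> S" using Q nf by (simp add: S_def)
  obtain M where M: "M \<in> S" "\<And>I. I \<in> S \<Longrightarrow> M \<subseteq> I \<Longrightarrow> I = M"
    by (rule exists_maximal_ideal_in[of S]) (use \<open>Q \<in> S\<close> in \<open>auto simp: S_def\<close>)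
  have iM: "ideal M R" and rM: "\<mm> \<subseteq> radical R M" and nM: "\<not> fin_length (carrier R) M"
    using M(1) by (auto simp: S_def)
  have "ideal_chain_length R (carrier R) (carrier R) 0"
    unfolding chain_length_def using oneideal
    by (auto simp: strict_chain_0_iff) (metis not0_implies_Suc strict_chain_Suc_iff strict_chain_subset psubsetE)
  then have "M \<noteq> carrier R" using nM ideal_chain_length_eq by blast
  then obtain c0 where c0: "c0 \<in> carrier R" "c0 \<notin> M" using idealD(1)[OF iM] by blast
  \<comment> \<open>a maximal \<open>(M : c)\<close> plays the role of an associated prime of \<open>R/M\<close>\<close>
  define T where "T = {elem_colon M c | c. c \<in> carrier R \<and> c \<notin> M}"
  obtain P where P: "P \<in> T" "\<And>I. I \<in> T \<Longrightarrow> P \<subseteq> I \<Longrightarrow> I = P"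
    by (rule exists_maximal_ideal_in[of T]) (use c0 elem_colon_ideal[OF _ iM] in \<open>auto simp: T_def\<close>)
  obtain c where c: "c \<in> carrier R" "c \<notin> M" "P = elem_colon M c" using P(1) unfolding T_def by blast
  have "\<mm> \<subseteq> P"
  proof
    fix r assume r: "r \<in> \<mm>"
    then have rc: "r \<in> carrier R" using m.Icarr by blast
    obtain k :: nat where k: "r [^] k \<in> M" using r rM unfolding radical_def by blast
    show "r \<in> P"
    proof (rule ccontr)
      assume "r \<notin> P"
      \<comment> \<open>multiplying \<open>c\<close> by \<open>r \<notin> (M : c)\<close> stays outside \<open>M\<close> and, by maximality, keeps the colon ideal\<close>
      have "c \<otimes> r [^] j \<notin> M" for j :: nat
      proof (induction j)
        case 0
        then show ?case using c by simp
      next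
        case (Suc j)
        let ?d = "c \<otimes> r [^] j"
        have d: "?d \<in> carrier R" using c rc by simp
        have "P \<subseteq> elem_colon M ?d"
        proof
          fix s assume s: "s \<in> P"
          then have sc: "s \<in> carrier R" "c \<otimes> s \<in> M" using c by (auto simp: elem_colon_def)
          have "r [^] j \<otimes> (c \<otimes> s) \<in> M" using idealD(4)[OF iM sc(2)] rc by simp
          moreover have "r [^] j \<otimes> (c \<otimes> s) = ?d \<otimes> s" using c rc sc by (simp add: m_ac)
          ultimately show "s \<in> elem_colon M ?d" using sc by (simp add: elem_colon_def)
        qed
        moreover have "elem_colon M ?d \<in> T" using d Suc.IH by (auto simp: T_def)
        ultimately have "elem_colon M ?d = P" using P(2) by blast
        then have "r \<notin> elem_colon M ?d" using \<open>r \<notin> P\<close> by simp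
        then have "?d \<otimes> r \<notin> M" using rc by (simp add: elem_colon_def)
        then show ?case using c rc by (simp add: m_assoc)
      qed
      moreover have "c \<otimes> r [^] k \<in> M" using idealD(4)[OF iM k c(1)] .
      ultimately show False by blast
    qed
  qed
  moreover have "\<one> \<notin> P" using c by (simp add: elem_colon_def)
  moreover have iP: "ideal P R" using c elem_colon_ideal[OF _ iM] by simp
  ultimately have "P = \<mm>" using m.I_maximal[OF iP] idealD(1)[OF iP] one_closed by blast
  define M' where "M' = mult_plus c (carrier R) M"
  have iM': "ideal M' R" unfolding M'_def by (rule mult_plus_ideal[OF c(1) oneideal iM])
  have MM': "M \<subseteq> M'" unfolding M'_def by (rule subset_mult_plus[OF c(1) oneideal iM])
  have "elem_colon M c \<inter> carrier R = \<mm>" using \<open>P = \<mm>\<close> c(3) idealD(1)[OF iP] by blast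
  then have "fin_length M' M"
    unfolding M'_def using length_quot_mult(1)[OF c(1) oneideal iM]
      ideal_chain_length_eq(1)[OF maximal_chain_length[OF max]] by simp
  moreover have "fin_length (carrier R) M'"
  proof (rule ccontr)
    assume "\<not> fin_length (carrier R) M'"
    moreover have "\<mm> \<subseteq> radical R M'" using rM MM' unfolding radical_def by blast
    ultimately have "M' = M" using M(2)[of M'] iM' MM' by (simp add: S_def)
    moreover have "c \<in> M'"
      unfolding M'_def by (rule mult_plusI[OF one_closed idealD(2)[OF iM]]) (use c in simp)
    ultimately show False using c(2) by simp
  qed
  ultimately show False using fin_length_trans(1) nM by blast
qed

section \<open>Length formula for products with a two-generated ideal\<close>

lemma ideal_prod_least:
  assumes "ideal M R" "\<And>i j. i \<in> I \<Longrightarrow> j \<in> J \<Longrightarrow> i \<otimes> j \<in> M"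
  shows "I \<cdot> J \<subseteq> M"
proof
  show "z \<in> M" if "z \<in> I \<cdot> J" for z
    using that by (induction rule: ideal_prod.induct) (auto intro: assms(2) idealD(3)[OF assms(1)])
qed

lemma two_gen_ideal_prod:
  assumes x: "x \<in> carrier R" and y: "y \<in> carrier R" and A: "ideal A R"
  shows "(Idl {x, y}) \<cdot> A = mult_plus x A (mult_plus y A {\<zero>})" (is "?J \<cdot> A = ?M")
proof
  have J: "ideal ?J R" by (rule genideal_ideal) (use x y in simp)
  have xyJ: "x \<in> ?J" "y \<in> ?J" using genideal_self[of "{x, y}"] x y by auto
  have JA: "ideal (?J \<cdot> A) R" by (rule ideal_prod_is_ideal[OF J A])
  have M0: "ideal (mult_plus y A {\<zero>}) R" by (rule mult_plus_ideal[OF y A zeroideal])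
  have M: "ideal ?M R" by (rule mult_plus_ideal[OF x A M0])
  have xa: "x \<otimes> a \<in> ?M" and ya: "y \<otimes> a \<in> ?M" if a: "a \<in> A" for a
  proof -
    note ac = idealD(7)[OF A a]
    show "x \<otimes> a \<in> ?M" by (rule mult_plusI[OF a idealD(2)[OF M0]]) (use x ac in simp)
    have "y \<otimes> a \<in> mult_plus y A {\<zero>}" by (rule mult_plusI[OF a]) (use y ac in auto)
    then show "y \<otimes> a \<in> ?M" using subset_mult_plus[OF x A M0] by blast
  qed
  show "?J \<cdot> A \<subseteq> ?M"
  proof (rule ideal_prod_least[OF M])
    fix j a assume j: "j \<in> ?J" and a: "a \<in> A"
    note ac = idealD(7)[OF A a]
    have "?J \<subseteq> elem_colon ?M a"
      by (rule genideal_minimal[OF elem_colon_ideal[OF ac M]])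
        (use xa[OF a] ya[OF a] x y ac in \<open>auto simp: elem_colon_def m_comm\<close>)
    then have "a \<otimes> j \<in> ?M" using j by (auto simp: elem_colon_def)
    then show "j \<otimes> a \<in> ?M" using m_comm[OF ac idealD(7)[OF J j]] by simp
  qed
  show "?M \<subseteq> ?J \<cdot> A"
  proof (intro mult_plus_least[OF JA])
    show "{\<zero>} \<subseteq> ?J \<cdot> A" using idealD(2)[OF JA] by simp
  qed (use xyJ in \<open>auto intro: ideal_prod.prod\<close>)
qed

lemma colon_two_gen:
  assumes x: "x \<in> carrier R" and y: "y \<in> carrier R" and A: "ideal A R"
  shows "colon R A (Idl {x, y}) = elem_colon A y \<inter> elem_colon A x"
proof
  have xyJ: "x \<in> Idl {x, y}" "y \<in> Idl {x, y}" using genideal_self[of "{x, y}"] x y by auto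
  then show "colon R A (Idl {x, y}) \<subseteq> elem_colon A y \<inter> elem_colon A x"
    using x y by (auto simp: colon_def elem_colon_def m_comm)
  show "elem_colon A y \<inter> elem_colon A x \<subseteq> colon R A (Idl {x, y})"
  proof
    fix r assume r: "r \<in> elem_colon A y \<inter> elem_colon A x"
    then have rc: "r \<in> carrier R" by (simp add: elem_colon_def)
    have "Idl {x, y} \<subseteq> elem_colon A r"
      by (rule genideal_minimal[OF elem_colon_ideal[OF rc A]])
        (use r x y rc in \<open>auto simp: elem_colon_def m_comm\<close>)
    then show "r \<in> colon R A (Idl {x, y})" using rc by (auto simp: colon_def elem_colon_def)
  qed
qed

text \<open>
  The vanishing of the first Koszul homology of \<open>x, y\<close>. This is all that the length formula uses of the
  Cohen-Macaulay property.
\<close>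
definition trivial_syzygies :: "'a \<Rightarrow> 'a \<Rightarrow> bool" where
  "trivial_syzygies x y \<longleftrightarrow> (\<forall>u\<in>carrier R. \<forall>v\<in>carrier R.
    u \<otimes> x \<oplus> v \<otimes> y = \<zero> \<longrightarrow> (\<exists>w\<in>carrier R. u = w \<otimes> y \<and> v = \<ominus> (w \<otimes> x)))"

lemma trivial_syzygiesE:
  assumes "trivial_syzygies x y" "u \<otimes> x \<oplus> v \<otimes> y = \<zero>" "u \<in> carrier R" "v \<in> carrier R"
  obtains w where "w \<in> carrier R" "u = w \<otimes> y" "v = \<ominus> (w \<otimes> x)"
  using assms unfolding trivial_syzygies_def by blast

text \<open>
  Classically this comes from the exact sequence
  \<open>0 \<rightarrow> R/(A : J) \<rightarrow> (R/A)\<^sup>2 \<rightarrow> J/JA \<rightarrow> 0\<close> with \<open>J = (x, y)\<close>. To stay within the ideals of \<open>R\<close>, the ideal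
  \<open>xR + JA\<close> is inserted between \<open>JA\<close> and \<open>J\<close>. Triviality of the syzygies identifies the two quotients:
  \<open>(xR + JA) : y = xR + A\<close> and \<open>JA : x = A + y(A : x)\<close>. What remains is to compare the colengths of
  \<open>xR + A\<close> and \<open>A + y(A : x)\<close> with that of \<open>A\<close>, again by multiplication by \<open>x\<close> and by \<open>y\<close>.
\<close>
lemma length_two_gen_prod:
  assumes x: "x \<in> carrier R" and y: "y \<in> carrier R" and syz: "trivial_syzygies x y"
    and A: "ideal A R" and fin: "fin_length (carrier R) ((Idl {x, y}) \<cdot> A)"
  shows "length_quot R (carrier R) ((Idl {x, y}) \<cdot> A) + length_quot R (carrier R) (colon R A (Idl {x, y}))
    = length_quot R (carrier R) (Idl {x, y}) + 2 * length_quot R (carrier R) A"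
proof -
  define J where "J = Idl {x, y}"
  define JA where "JA = J \<cdot> A"
  define C where "C = elem_colon A x"
  define D where "D = elem_colon A y \<inter> C"
  define N where "N = mult_plus x (carrier R) JA"
  define V where "V = mult_plus x (carrier R) A"
  define W where "W = mult_plus y C A"
  have xyJ: "x \<in> J" "y \<in> J" unfolding J_def using genideal_self[of "{x, y}"] x y by auto
  have J: "ideal J R" unfolding J_def by (rule genideal_ideal) (use x y in simp)
  have JA: "ideal JA R" unfolding JA_def by (rule ideal_prod_is_ideal[OF J A])
  have C: "ideal C R" unfolding C_def by (rule elem_colon_ideal[OF x A])
  have D: "ideal D R" unfolding D_def by (rule i_intersect[OF elem_colon_ideal[OF y A] C])
  have N: "ideal N R" unfolding N_def by (rule mult_plus_ideal[OF x oneideal JA])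
  have V: "ideal V R" unfolding V_def by (rule mult_plus_ideal[OF x oneideal A])
  have W: "ideal W R" unfolding W_def by (rule mult_plus_ideal[OF y C A])
  have JA_eq: "JA = mult_plus x A (mult_plus y A {\<zero>})"
    unfolding JA_def J_def by (rule two_gen_ideal_prod[OF x y A])
  have M0: "ideal (mult_plus y A {\<zero>}) R" by (rule mult_plus_ideal[OF y A zeroideal])
  have JAI: "x \<otimes> a \<oplus> y \<otimes> b \<in> JA" if "a \<in> A" "b \<in> A" for a b
    using that xyJ idealD(3)[OF JA] unfolding JA_def by (simp add: ideal_prod.prod)
  have JAE: "\<exists>a\<in>A. \<exists>b\<in>A. z = x \<otimes> a \<oplus> y \<otimes> b" if "z \<in> JA" for z
  proof -
    obtain a z' where "z = x \<otimes> a \<oplus> z'" "a \<in> A" "z' \<in> mult_plus y A {\<zero>}"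
      by (rule mult_plusE[OF \<open>z \<in> JA\<close>[unfolded JA_eq] A M0])
    moreover obtain b where "z' = y \<otimes> b \<oplus> \<zero>" "b \<in> A" "b \<in> carrier R"
      by (rule mult_plusE[OF \<open>z' \<in> _\<close> A zeroideal]) auto
    ultimately show ?thesis using y by auto
  qed
  have JA_J: "JA \<subseteq> J" and JA_A: "JA \<subseteq> A" unfolding JA_def using ideal_prod_inter[OF J A] by auto
  have JA_N: "JA \<subseteq> N" unfolding N_def by (rule subset_mult_plus[OF x oneideal JA])
  have N_J: "N \<subseteq> J"
    unfolding N_def by (rule mult_plus_least[OF J JA_J]) (use xyJ idealD(5)[OF J] in blast)
  have A_V: "A \<subseteq> V" unfolding V_def by (rule subset_mult_plus[OF x oneideal A])
  have A_W: "A \<subseteq> W" unfolding W_def by (rule subset_mult_plus[OF y C A])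
  have A_D: "A \<subseteq> D"
    using idealD(4)[OF A] idealD(7)[OF A] x y by (auto simp: D_def C_def elem_colon_def)
  have D_C: "D \<subseteq> C" by (auto simp: D_def)
  have fin': "fin_length I I'" if "ideal I R" "ideal I' R" "JA \<subseteq> I'" "I' \<subseteq> I" for I I'
  proof -
    have "fin_length (carrier R) JA" using fin unfolding JA_def J_def .
    then have "fin_length (carrier R) I'"
      using fin_length_split(1)[OF _ that(2,3)] that idealD(1)[OF that(1)] by blast
    then show ?thesis using fin_length_split(2)[OF _ that(1,4)] idealD(1)[OF that(1)] by blast
  qed
  have carr: "I \<subseteq> carrier R" if "ideal I R" for I using idealD(1)[OF that] .
  have add: "length_quot R I I'' = length_quot R I I' + length_quot R I' I''"
    if "ideal I R" "ideal I' R" "ideal I'' R" "JA \<subseteq> I''" "I'' \<subseteq> I'" "I' \<subseteq> I" for I I' I''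
    by (rule length_quot_add[OF fin' that(2) that(5,6)]) (use that in auto)
  have J_eq: "J = mult_plus y (carrier R) N"
  proof
    show "mult_plus y (carrier R) N \<subseteq> J"
      by (rule mult_plus_least[OF J N_J]) (use xyJ idealD(5)[OF J] in blast)
    have i: "ideal (mult_plus y (carrier R) N) R" by (rule mult_plus_ideal[OF y oneideal N])
    have "x \<in> N" unfolding N_def
      by (rule mult_plusI[OF one_closed idealD(2)[OF JA]]) (use x in simp)
    then have "x \<in> mult_plus y (carrier R) N" using subset_mult_plus[OF y oneideal N] by blast
    moreover have "y \<in> mult_plus y (carrier R) N"
      by (rule mult_plusI[OF one_closed idealD(2)[OF N]]) (use y in simp)
    ultimately show "J \<subseteq> mult_plus y (carrier R) N"
      unfolding J_def by (intro genideal_minimal[OF i]) auto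
  qed
  have Ny: "elem_colon N y \<inter> carrier R = V"
  proof
    show "elem_colon N y \<inter> carrier R \<subseteq> V"
    proof
      fix r assume "r \<in> elem_colon N y \<inter> carrier R"
      then have r: "r \<in> carrier R" "y \<otimes> r \<in> N" by (auto simp: elem_colon_def)
      obtain s z where s: "y \<otimes> r = x \<otimes> s \<oplus> z" "s \<in> carrier R" "z \<in> JA" "z \<in> carrier R"
        by (rule mult_plusE[OF r(2)[unfolded N_def] oneideal JA])
      obtain a b where ab: "a \<in> A" "b \<in> A" "z = x \<otimes> a \<oplus> y \<otimes> b" using JAE[OF s(3)] by blast
      have abc: "a \<in> carrier R" "b \<in> carrier R" using ab idealD(7)[OF A] by auto
      \<comment> \<open>\<open>y r = x s + x a + y b\<close> is the syzygy \<open>(s + a, b - r)\<close>\<close>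
      have "(s \<oplus> a) \<otimes> x \<oplus> (b \<ominus> r) \<otimes> y = (x \<otimes> s \<oplus> (x \<otimes> a \<oplus> y \<otimes> b)) \<ominus> y \<otimes> r"
        using abc s r x y by algebra
      also have "\<dots> = \<zero>" unfolding s(1) ab(3) using abc s r x y by algebra
      finally obtain w where w: "w \<in> carrier R" "b \<ominus> r = \<ominus> (w \<otimes> x)"
        by (rule trivial_syzygiesE[OF syz]) (use abc s r in auto)
      have "r = b \<ominus> (b \<ominus> r)" using abc r by algebra
      also have "\<dots> = x \<otimes> w \<oplus> b" unfolding w(2) using abc w x by algebra
      finally show "r \<in> V" unfolding V_def by (intro mult_plusI[OF w(1) ab(2)])
    qed
    show "V \<subseteq> elem_colon N y \<inter> carrier R"
    proof
      fix r assume rV: "r \<in> V"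
      obtain s b where s: "r = x \<otimes> s \<oplus> b" "s \<in> carrier R" "b \<in> A" "b \<in> carrier R"
        by (rule mult_plusE[OF rV[unfolded V_def] oneideal A])
      have "y \<otimes> r = x \<otimes> (y \<otimes> s) \<oplus> (x \<otimes> \<zero> \<oplus> y \<otimes> b)" unfolding s(1) using s x y by algebra
      then have "y \<otimes> r \<in> N" unfolding N_def
        by (intro mult_plusI[OF _ JAI[OF idealD(2)[OF A] s(3)]]) (use s y in auto)
      then show "r \<in> elem_colon N y \<inter> carrier R" using s x by (simp add: elem_colon_def)
    qed
  qed
  have JAx: "elem_colon JA x \<inter> carrier R = W"
  proof
    show "elem_colon JA x \<inter> carrier R \<subseteq> W"
    proof
      fix r assume "r \<in> elem_colon JA x \<inter> carrier R"
      then have r: "r \<in> carrier R" "x \<otimes> r \<in> JA" by (auto simp: elem_colon_def)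
      obtain a b where ab: "a \<in> A" "b \<in> A" "x \<otimes> r = x \<otimes> a \<oplus> y \<otimes> b" using JAE[OF r(2)] by blast
      have abc: "a \<in> carrier R" "b \<in> carrier R" using ab idealD(7)[OF A] by auto
      \<comment> \<open>\<open>x r = x a + y b\<close> is the syzygy \<open>(r - a, - b)\<close>\<close>
      have "(r \<ominus> a) \<otimes> x \<oplus> (\<ominus> b) \<otimes> y = x \<otimes> r \<ominus> (x \<otimes> a \<oplus> y \<otimes> b)"
        using abc r x y by algebra
      also have "\<dots> = \<zero>" unfolding ab(3) using abc r x y by algebra
      finally obtain w where w: "w \<in> carrier R" "r \<ominus> a = w \<otimes> y" "\<ominus> b = \<ominus> (w \<otimes> x)"
        by (rule trivial_syzygiesE[OF syz]) (use abc r in auto)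
      have "b = \<ominus> (\<ominus> b)" using abc by simp
      also have "\<dots> = x \<otimes> w" unfolding w(3) using w x by algebra
      finally have "w \<in> C" using w ab(2) by (simp add: C_def elem_colon_def)
      have "r = (r \<ominus> a) \<oplus> a" using abc r by algebra
      also have "\<dots> = y \<otimes> w \<oplus> a" unfolding w(2) using abc w y by algebra
      finally show "r \<in> W" unfolding W_def by (intro mult_plusI[OF \<open>w \<in> C\<close> ab(1)])
    qed
    show "W \<subseteq> elem_colon JA x \<inter> carrier R"
    proof
      fix r assume rW: "r \<in> W"
      obtain w a where w: "r = y \<otimes> w \<oplus> a" "w \<in> C" "a \<in> A" "w \<in> carrier R" "a \<in> carrier R"
        by (rule mult_plusE[OF rW[unfolded W_def] C A])
      have "x \<otimes> r = x \<otimes> a \<oplus> y \<otimes> (x \<otimes> w)" unfolding w(1) using w x y by algebra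
      moreover have "x \<otimes> w \<in> A" using w(2) by (simp add: C_def elem_colon_def)
      ultimately have "x \<otimes> r \<in> JA" using JAI[OF w(3)] by simp
      then show "r \<in> elem_colon JA x \<inter> carrier R" using w y by (simp add: elem_colon_def)
    qed
  qed
  have 1: "length_quot R J N = length_quot R (carrier R) V"
    using length_quot_mult(2)[OF y oneideal N] fin'[OF oneideal V] A_V JA_A carr[OF V]
    unfolding J_eq[symmetric] Ny by blast
  have 2: "length_quot R N JA = length_quot R (carrier R) W"
    using length_quot_mult(2)[OF x oneideal JA] fin'[OF oneideal W] A_W JA_A carr[OF W]
    unfolding N_def[symmetric] JAx by blast
  have "elem_colon A x \<inter> carrier R = C" using carr[OF C] by (auto simp: C_def)
  then have 3: "length_quot R V A = length_quot R (carrier R) C"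
    using length_quot_mult(2)[OF x oneideal A] fin'[OF oneideal C] A_D D_C JA_A carr[OF C]
    unfolding V_def[symmetric] by auto
  have 4: "length_quot R W A = length_quot R C D"
    using length_quot_mult(2)[OF y C A] fin'[OF C D] A_D D_C JA_A
    unfolding W_def[symmetric] D_def[symmetric] by blast
  have "length_quot R (carrier R) JA = length_quot R (carrier R) J + length_quot R J JA"
    by (rule add) (use JA_J JA J oneideal carr in auto)
  moreover have "length_quot R J JA = length_quot R J N + length_quot R N JA"
    by (rule add) (use JA_N N_J JA J N in auto)
  moreover have "length_quot R (carrier R) A = length_quot R (carrier R) V + length_quot R V A"
    by (rule add) (use A_V JA_A A V oneideal carr in auto)
  moreover have "length_quot R (carrier R) A = length_quot R (carrier R) W + length_quot R W A"
    by (rule add) (use A_W JA_A A W oneideal carr in auto)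
  moreover have "length_quot R (carrier R) D = length_quot R (carrier R) C + length_quot R C D"
    by (rule add) (use A_D D_C JA_A C D oneideal carr in auto)
  ultimately have "length_quot R (carrier R) JA + length_quot R (carrier R) D
      = length_quot R (carrier R) J + 2 * length_quot R (carrier R) A"
    using 1 2 3 4 by linarith
  then show ?thesis
    unfolding colon_two_gen[OF x y A] by (simp add: JA_def D_def C_def J_def)
qed

section \<open>Syzygies of parameters in depth two\<close>

lemma nonzerodivisor_power:
  assumes a: "a \<in> carrier R" and nz: "\<And>r. r \<in> carrier R \<Longrightarrow> r \<otimes> a = \<zero> \<Longrightarrow> r = \<zero>"
    and r: "r \<in> carrier R" "r \<otimes> a [^] (k::nat) = \<zero>"
  shows "r = \<zero>"
  using r
proof (induction k)
  case 0
  then show ?case by simp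
next
  case (Suc k)
  have "(r \<otimes> a [^] k) \<otimes> a = \<zero>" using Suc.prems a by (simp add: m_assoc)
  then show ?case using nz[of "r \<otimes> a [^] k"] Suc a by simp
qed

text \<open>
  Powers of a regular sequence of length two are again regular in the second step: one factor \<open>a\<close> at a
  time can be cancelled, since \<open>r b \<in> (a)\<close> forces \<open>r \<in> (a)\<close>.
\<close>
lemma regular_mod_power:
  assumes a: "a \<in> carrier R" and b: "b \<in> carrier R"
    and nz: "\<And>r. r \<in> carrier R \<Longrightarrow> r \<otimes> a = \<zero> \<Longrightarrow> r = \<zero>"
    and reg: "\<And>r s. r \<in> carrier R \<Longrightarrow> s \<in> carrier R \<Longrightarrow> r \<otimes> b = s \<otimes> a \<Longrightarrow> \<exists>t\<in>carrier R. r = t \<otimes> a"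
    and rs: "r \<in> carrier R" "s \<in> carrier R" "r \<otimes> b [^] (l::nat) = s \<otimes> a [^] (k::nat)"
  shows "\<exists>t\<in>carrier R. r = t \<otimes> a [^] k"
proof -
  have cancel: "u = v" if "u \<in> carrier R" "v \<in> carrier R" "u \<otimes> a = v \<otimes> a" for u v
  proof -
    have "(u \<ominus> v) \<otimes> a = u \<otimes> a \<ominus> v \<otimes> a" using that a by algebra
    then have "(u \<ominus> v) \<otimes> a = \<zero>" using that a by (simp add: r_neg a_minus_def)
    then have "u \<ominus> v = \<zero>" using nz that by simp
    then show ?thesis using that by (simp add: r_right_minus_eq)
  qed
  have 1: "\<exists>t\<in>carrier R. r = t \<otimes> a [^] k"
    if "r \<in> carrier R" "s \<in> carrier R" "r \<otimes> b = s \<otimes> a [^] k" for r s and k :: nat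
    using that
  proof (induction k arbitrary: r)
    case 0
    then show ?case by auto
  next
    case (Suc k)
    have "r \<otimes> b = (s \<otimes> a [^] k) \<otimes> a" using Suc.prems a by (simp add: m_assoc)
    then obtain t where t: "t \<in> carrier R" "r = t \<otimes> a"
      using reg[of r "s \<otimes> a [^] k"] Suc.prems a by auto
    have "(t \<otimes> b) \<otimes> a = r \<otimes> b" unfolding t(2) using t a b by (simp add: m_ac)
    also have "\<dots> = (s \<otimes> a [^] k) \<otimes> a" by fact
    finally have "t \<otimes> b = s \<otimes> a [^] k" using cancel[of "t \<otimes> b" "s \<otimes> a [^] k"] Suc.prems t a b by simp
    then obtain t' where "t' \<in> carrier R" "t = t' \<otimes> a [^] k"
      using Suc.IH[OF t(1) Suc.prems(2)] by blast
    then show ?case unfolding t(2) using a by (auto simp: m_assoc)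
  qed
  show ?thesis using rs
  proof (induction l arbitrary: r)
    case 0
    then show ?case by auto
  next
    case (Suc l)
    have "(r \<otimes> b) \<otimes> b [^] l = s \<otimes> a [^] k" 
      using Suc.prems b by (metis m_assoc m_comm nat_pow_Suc nat_pow_closed)
    then obtain t where "t \<in> carrier R" "r \<otimes> b = t \<otimes> a [^] k"
      using Suc.IH[of "r \<otimes> b"] Suc.prems b by auto
    then show ?case using 1 Suc.prems by blast
  qed
qed

text \<open>
  Depth sensitivity of the Koszul complex, made explicit. Let \<open>u x + v y = 0\<close> and \<open>a = p x + q y\<close>. Then
  \<open>w = q u - p v\<close> satisfies \<open>u a = w y\<close> and \<open>v a = - w x\<close>, so \<open>w\<close> multiplies \<open>(x, y)\<close>, and with it \<open>b\<close>,
  into \<open>(a)\<close>. As \<open>b\<close> is regular modulo \<open>a\<close>, \<open>w\<close> is a multiple of \<open>a\<close>, and \<open>a\<close> can be cancelled.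
\<close>
lemma trivial_syzygies_of_regular_sequence:
  assumes x: "x \<in> carrier R" and y: "y \<in> carrier R"
    and a: "a \<in> Idl {x, y}" and b: "b \<in> Idl {x, y}"
    and nz: "\<And>r. r \<in> carrier R \<Longrightarrow> r \<otimes> a = \<zero> \<Longrightarrow> r = \<zero>"
    and reg: "\<And>r s. r \<in> carrier R \<Longrightarrow> s \<in> carrier R \<Longrightarrow> r \<otimes> b = s \<otimes> a \<Longrightarrow> \<exists>t\<in>carrier R. r = t \<otimes> a"
  shows "trivial_syzygies x y"
  unfolding trivial_syzygies_def
proof (intro ballI impI)
  fix u v assume u: "u \<in> carrier R" and v: "v \<in> carrier R" and uv: "u \<otimes> x \<oplus> v \<otimes> y = \<zero>"
  have J: "ideal (Idl {x, y}) R" by (rule genideal_ideal) (use x y in simp)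
  have ac: "a \<in> carrier R" and bc: "b \<in> carrier R" using a b idealD(7)[OF J] by auto
  have comb: "\<exists>p\<in>carrier R. \<exists>q\<in>carrier R. z = p \<otimes> x \<oplus> q \<otimes> y" if z: "z \<in> Idl {x, y}" for z
  proof -
    have M0: "ideal (mult_plus y (carrier R) {\<zero>}) R" by (rule mult_plus_ideal[OF y oneideal zeroideal])
    have "z \<in> mult_plus x (carrier R) (mult_plus y (carrier R) {\<zero>})"
      using z two_gen_ideal_prod[OF x y oneideal] ideal_prod_one[OF J] by simp
    then obtain p z' where p: "z = x \<otimes> p \<oplus> z'" "p \<in> carrier R" "z' \<in> mult_plus y (carrier R) {\<zero>}"
      by (rule mult_plusE[OF _ oneideal M0])
    obtain q where "z' = y \<otimes> q \<oplus> \<zero>" "q \<in> carrier R"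
      by (rule mult_plusE[OF p(3) oneideal zeroideal]) auto
    then show ?thesis using p x y m_comm by auto
  qed
  obtain p q where pq: "p \<in> carrier R" "q \<in> carrier R" "a = p \<otimes> x \<oplus> q \<otimes> y" using comb[OF a] by blast
  obtain p' q' where pq': "p' \<in> carrier R" "q' \<in> carrier R" "b = p' \<otimes> x \<oplus> q' \<otimes> y" using comb[OF b] by blast
  have ux: "u \<otimes> x = \<ominus> (v \<otimes> y)" using uv u v x y by (metis m_closed minus_equality minus_minus)
  define w where "w = q \<otimes> u \<ominus> p \<otimes> v"
  have w: "w \<in> carrier R" using pq u v by (simp add: w_def)
  have au: "u \<otimes> a = w \<otimes> y"
  proof -
    have "u \<otimes> a = p \<otimes> (u \<otimes> x) \<oplus> q \<otimes> u \<otimes> y" unfolding pq(3) using pq u v x y by algebra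
    also have "\<dots> = w \<otimes> y" unfolding ux w_def using pq u v x y by algebra
    finally show ?thesis .
  qed
  have av: "v \<otimes> a = \<ominus> (w \<otimes> x)"
  proof -
    have vy: "v \<otimes> y = \<ominus> (u \<otimes> x)" using ux u v x y by simp
    have "v \<otimes> a = p \<otimes> v \<otimes> x \<oplus> q \<otimes> (v \<otimes> y)" unfolding pq(3) using pq u v x y by algebra
    also have "\<dots> = \<ominus> (w \<otimes> x)" unfolding vy w_def using pq u v x y by algebra
    finally show ?thesis .
  qed
  have "w \<otimes> b = p' \<otimes> (w \<otimes> x) \<oplus> q' \<otimes> (w \<otimes> y)" unfolding pq'(3) using pq' w x y by algebra
  also have "w \<otimes> x = \<ominus> (v \<otimes> a)" using av w x v ac by simp
  also have "w \<otimes> y = u \<otimes> a" using au by simp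
  also have "p' \<otimes> \<ominus> (v \<otimes> a) \<oplus> q' \<otimes> (u \<otimes> a) = (q' \<otimes> u \<ominus> p' \<otimes> v) \<otimes> a"
    using pq' u v ac by algebra
  finally obtain w' where w': "w' \<in> carrier R" "w = w' \<otimes> a"
    using reg[OF w, of "q' \<otimes> u \<ominus> p' \<otimes> v"] pq' u v by auto
  have "(u \<ominus> w' \<otimes> y) \<otimes> a = u \<otimes> a \<ominus> w' \<otimes> a \<otimes> y" using u w' y ac by algebra
  then have "(u \<ominus> w' \<otimes> y) \<otimes> a = \<zero>" using au w' w y by (simp add: r_neg a_minus_def)
  then have "u \<ominus> w' \<otimes> y = \<zero>" using nz u w' y by simp
  then have 1: "u = w' \<otimes> y" using u w' y by (simp add: r_right_minus_eq)
  have "(v \<oplus> w' \<otimes> x) \<otimes> a = v \<otimes> a \<oplus> w' \<otimes> a \<otimes> x" using v w' x ac by algebra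
  then have "(v \<oplus> w' \<otimes> x) \<otimes> a = \<zero>" using av w' w x by (simp add: l_neg)
  then have "v \<oplus> w' \<otimes> x = \<zero>" using nz v w' x by simp
  then have 2: "v = \<ominus> (w' \<otimes> x)" using v w' x by (simp add: minus_equality)
  show "\<exists>w\<in>carrier R. u = w \<otimes> y \<and> v = \<ominus> (w \<otimes> x)" using 1 2 w'(1) by blast
qed

end

section \<open>Graded ideals over Rees algebras\<close>

text \<open>
  The degree \<open>n\<close> part of the graded submodule of \<open>\<Oplus>\<^sub>n B\<^sub>n t\<^sup>n\<close> over \<open>\<Oplus>\<^sub>n E\<^sub>n t\<^sup>n\<close> that is generated in
  degrees at most \<open>c\<close>.
\<close>
definition graded_span :: "('a, 'b) ring_scheme \<Rightarrow> (nat \<Rightarrow> 'a set) \<Rightarrow> (nat \<Rightarrow> 'a set) \<Rightarrow> nat \<Rightarrow> nat \<Rightarrow> 'a set" where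
  "graded_span R E B c n = genideal R {e \<otimes>\<^bsub>R\<^esub> b | e b j. j \<le> c \<and> j \<le> n \<and> e \<in> E (n - j) \<and> b \<in> B j}"

text \<open>
  The condition that \<open>\<Oplus>\<^sub>n B\<^sub>n t\<^sup>n\<close> is closed under multiplication by \<open>\<Oplus>\<^sub>n E\<^sub>n t\<^sup>n\<close>.
\<close>
definition graded_ideals :: "('a, 'b) ring_scheme \<Rightarrow> (nat \<Rightarrow> 'a set) \<Rightarrow> (nat \<Rightarrow> 'a set) \<Rightarrow> bool" where
  "graded_ideals R E B \<longleftrightarrow> (\<forall>n. ideal (B n) R) \<and>
    (\<forall>m n e b. e \<in> E m \<longrightarrow> b \<in> B n \<longrightarrow> e \<otimes>\<^bsub>R\<^esub> b \<in> B (m + n))"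

context cring
begin

lemma graded_idealsD:
  assumes "graded_ideals R E B"
  shows "ideal (B n) R" "e \<in> E m \<Longrightarrow> b \<in> B n \<Longrightarrow> e \<otimes> b \<in> B (m + n)"
  using assms unfolding graded_ideals_def by auto

lemma finsum_in_ideal:
  assumes "ideal I R" "finite A" "\<And>i. i \<in> A \<Longrightarrow> f i \<in> I"
  shows "(\<Oplus>i\<in>A. f i) \<in> I"
  using assms(2,3)
proof (induction A rule: finite_induct)
  case empty
  then show ?case using idealD(2)[OF assms(1)] by simp
next
  case (insert i A)
  have "(\<Oplus>i\<in>insert i A. f i) = f i \<oplus> (\<Oplus>i\<in>A. f i)"
    using insert idealD(7)[OF assms(1)] by (intro finsum_insert) auto
  then show ?case using insert idealD(3)[OF assms(1)] by simp
qed

lemma rees_simps: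
  "carrier (rees_algebra R B) = {p \<in> carrier (UP R). \<forall>n. UnivPoly.coeff (UP R) p n \<in> B n}"
  "mult (rees_algebra R B) = mult (UP R)" "add (rees_algebra R B) = add (UP R)"
  "zero (rees_algebra R B) = zero (UP R)" "one (rees_algebra R B) = one (UP R)"
  by (auto simp: rees_algebra_def)

lemma rees_closed:
  assumes "graded_ideals R E B"
  shows "\<zero>\<^bsub>UP R\<^esub> \<in> carrier (rees_algebra R B)"
    and "p \<in> carrier (rees_algebra R B) \<Longrightarrow> q \<in> carrier (rees_algebra R B) \<Longrightarrow>
      p \<oplus>\<^bsub>UP R\<^esub> q \<in> carrier (rees_algebra R B)"
    and "e \<in> carrier (rees_algebra R E) \<Longrightarrow> q \<in> carrier (rees_algebra R B) \<Longrightarrow>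
      e \<otimes>\<^bsub>UP R\<^esub> q \<in> carrier (rees_algebra R B)"
proof -
  interpret P: UP_cring R "UP R" by (unfold_locales)
  note B = graded_idealsD(1)[OF assms]
  show "\<zero>\<^bsub>UP R\<^esub> \<in> carrier (rees_algebra R B)" using idealD(2)[OF B] by (simp add: rees_simps)
  show "p \<in> carrier (rees_algebra R B) \<Longrightarrow> q \<in> carrier (rees_algebra R B) \<Longrightarrow>
      p \<oplus>\<^bsub>UP R\<^esub> q \<in> carrier (rees_algebra R B)"
    using idealD(3)[OF B] by (simp add: rees_simps)
  show "e \<otimes>\<^bsub>UP R\<^esub> q \<in> carrier (rees_algebra R B)"
    if "e \<in> carrier (rees_algebra R E)" "q \<in> carrier (rees_algebra R B)"
  proof -
    have "(\<Oplus>i\<in>{..n}. UnivPoly.coeff (UP R) e i \<otimes> UnivPoly.coeff (UP R) q (n - i)) \<in> B n" for n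
    proof (rule finsum_in_ideal[OF B])
      fix i assume "i \<in> {..n}"
      then have n: "i + (n - i) = n" by simp
      show "UnivPoly.coeff (UP R) e i \<otimes> UnivPoly.coeff (UP R) q (n - i) \<in> B n"
        using graded_idealsD(2)[OF assms, of _ i _ "n - i"] that unfolding n by (simp add: rees_simps)
    qed simp
    then show ?thesis using that by (simp add: rees_simps)
  qed
qed

lemma rees_ideal:
  assumes S: "cring (rees_algebra R E)" and B: "graded_ideals R E B" and BE: "\<And>n. B n \<subseteq> E n"
  shows "ideal (carrier (rees_algebra R B)) (rees_algebra R E)"
proof -
  interpret S: cring "rees_algebra R E" by fact
  show ?thesis
    by (rule S.ideal_subset_closedI)
      (use rees_closed[OF B] BE in \<open>auto simp: rees_simps subset_eq\<close>)
qed

lemma graded_span_gens_carrier: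
  assumes "\<And>n. E n \<subseteq> carrier R" "\<And>n. B n \<subseteq> carrier R"
  shows "{e \<otimes> b | e b j. j \<le> c \<and> j \<le> n \<and> e \<in> E (n - j) \<and> b \<in> B j} \<subseteq> carrier R"
  using assms by blast

lemma graded_span_least:
  assumes "ideal L R" "\<And>j e b. j \<le> c \<Longrightarrow> j \<le> n \<Longrightarrow> e \<in> E (n - j) \<Longrightarrow> b \<in> B j \<Longrightarrow> e \<otimes> b \<in> L"
  shows "graded_span R E B c n \<subseteq> L"
  unfolding graded_span_def by (rule genideal_minimal[OF assms(1)]) (use assms(2) in blast)

lemma graded_span_genI:
  assumes "graded_ideals R E E" "graded_ideals R E B"
    and "j \<le> c" "j \<le> n" "e \<in> E (n - j)" "b \<in> B j"
  shows "e \<otimes> b \<in> graded_span R E B c n"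
proof -
  have "{e \<otimes> b | e b j. j \<le> c \<and> j \<le> n \<and> e \<in> E (n - j) \<and> b \<in> B j} \<subseteq> graded_span R E B c n"
    unfolding graded_span_def
    by (rule genideal_self, rule graded_span_gens_carrier)
      (rule idealD(1)[OF graded_idealsD(1)[OF assms(1)]] idealD(1)[OF graded_idealsD(1)[OF assms(2)]])+
  then show ?thesis using assms(3-) by blast
qed

lemma graded_span_graded:
  assumes E: "graded_ideals R E E" and B: "graded_ideals R E B"
  shows "graded_ideals R E (graded_span R E B c)"
  unfolding graded_ideals_def
proof (intro conjI allI impI)
  note EC = idealD(1)[OF graded_idealsD(1)[OF E]] and BC = idealD(1)[OF graded_idealsD(1)[OF B]]
  have id: "ideal (graded_span R E B c n) R" for n
    unfolding graded_span_def by (rule genideal_ideal[OF graded_span_gens_carrier[OF EC BC]])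
  then show "ideal (graded_span R E B c n) R" for n .
  show "e \<otimes> b \<in> graded_span R E B c (m + n)"
    if e: "e \<in> E m" and b: "b \<in> graded_span R E B c n" for m n e b
  proof -
    have ec: "e \<in> carrier R" using e EC by blast
    have "graded_span R E B c n \<subseteq> elem_colon (graded_span R E B c (m + n)) e"
    proof (rule graded_span_least[OF elem_colon_ideal[OF ec id]])
      fix j f z assume j: "j \<le> c" "j \<le> n" "f \<in> E (n - j)" "z \<in> B j"
      have fz: "f \<in> carrier R" "z \<in> carrier R" using j EC BC by blast+
      have "e \<otimes> f \<in> E (m + (n - j))" using graded_idealsD(2)[OF E e j(3)] .
      then have "e \<otimes> f \<in> E (m + n - j)" using j(2) by simp
      then have "(e \<otimes> f) \<otimes> z \<in> graded_span R E B c (m + n)"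
        using graded_span_genI[OF E B j(1) _ _ j(4), of "m + n" "e \<otimes> f"] j(2) by simp
      then show "f \<otimes> z \<in> elem_colon (graded_span R E B c (m + n)) e"
        using fz ec by (simp add: elem_colon_def m_assoc)
    qed
    then show ?thesis using b by (auto simp: elem_colon_def)
  qed
qed

lemma graded_span_subset:
  assumes "graded_ideals R E B"
  shows "graded_span R E B c n \<subseteq> B n"
  using graded_idealsD[OF assms] by (intro graded_span_least) (metis le_add_diff_inverse2)+

text \<open>
  Finitely many polynomials have bounded degree, and a polynomial of degree at most \<open>c\<close> has all its
  coefficients in the span of degrees at most \<open>c\<close>: for \<open>n \<le> c\<close> the span is all of \<open>B\<^sub>n\<close>.
\<close>
lemma finite_subset_graded_span:
  assumes E: "graded_ideals R E E" "E 0 = carrier R" and B: "graded_ideals R E B"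
    and G: "finite G" "G \<subseteq> carrier (rees_algebra R B)"
  shows "\<exists>c. G \<subseteq> carrier (rees_algebra R (graded_span R E B c))"
proof -
  interpret P: UP_cring R "UP R" by (unfold_locales)
  note EC = idealD(1)[OF graded_idealsD(1)[OF E(1)]] and BC = idealD(1)[OF graded_idealsD(1)[OF B]]
  have "\<forall>p\<in>G. \<exists>c. \<forall>n>c. UnivPoly.coeff (UP R) p n = \<zero>"
  proof
    fix p assume "p \<in> G"
    then have "p \<in> carrier (UP R)" using G(2) by (auto simp: rees_simps)
    then show "\<exists>c. \<forall>n>c. UnivPoly.coeff (UP R) p n = \<zero>"
      by (intro exI[of _ "deg R p"]) (auto intro: P.deg_aboveD)
  qed
  then obtain d where d: "\<And>p n. p \<in> G \<Longrightarrow> n > d p \<Longrightarrow> UnivPoly.coeff (UP R) p n = \<zero>" by metis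
  define c where "c = Max (d ` G)"
  have c: "UnivPoly.coeff (UP R) p n = \<zero>" if "p \<in> G" "n > c" for p n
  proof -
    have "d p \<le> c" unfolding c_def using that G(1) by (intro Max_ge) auto
    then show ?thesis using d that by simp
  qed
  have "UnivPoly.coeff (UP R) p n \<in> graded_span R E B c n" if p: "p \<in> G" for p n
  proof (cases "n > c")
    case True
    then show ?thesis using c[OF p] idealD(2)[OF graded_idealsD(1)[OF graded_span_graded[OF E(1) B]]] by simp
  next
    case False
    let ?b = "UnivPoly.coeff (UP R) p n"
    have b: "?b \<in> B n" using p G(2) by (auto simp: rees_simps)
    have "\<one> \<otimes> ?b \<in> graded_span R E B c n"
      using graded_span_genI[OF E(1) B _ _ _ b] False E(2) by simp
    then show ?thesis using b BC by (simp add: subset_eq)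
  qed
  then have "G \<subseteq> carrier (rees_algebra R (graded_span R E B c))"
    using G(2) by (auto simp: rees_simps)
  then show ?thesis ..
qed

text \<open>
  Graded pieces are recovered from polynomials through monomials.
\<close>
lemma rees_subset_imp_subset:
  assumes "\<And>n. ideal (B n) R" "\<And>n. ideal (S n) R"
    and "carrier (rees_algebra R B) \<subseteq> carrier (rees_algebra R S)"
  shows "B n \<subseteq> S n"
proof
  interpret P: UP_cring R "UP R" by (unfold_locales)
  fix b assume b: "b \<in> B n"
  then have bc: "b \<in> carrier R" using idealD(7)[OF assms(1)] by blast
  then have "monom (UP R) b n \<in> carrier (rees_algebra R B)"
    using b idealD(2)[OF assms(1)] by (auto simp: rees_simps)
  then have "UnivPoly.coeff (UP R) (monom (UP R) b n) n \<in> S n" using assms(3) by (auto simp: rees_simps)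
  then show "b \<in> S n" using bc by simp
qed

text \<open>
  An ideal of a Noetherian Rees algebra is generated in bounded degree. This single fact is used in place
  of both the Artin--Rees lemma and the finite generation of graded modules.
\<close>
lemma noetherian_rees_bounded_span:
  assumes noeth: "noetherian_ring (rees_algebra R E)" 
    and E: "graded_ideals R E E" "E 0 = carrier R"
    and B: "graded_ideals R E B" "\<And>n. B n \<subseteq> E n"
  shows "\<exists>c. \<forall>n. B n \<subseteq> graded_span R E B c n"
proof -
  interpret S: noetherian_ring "rees_algebra R E" by fact
  interpret P: UP_cring R "UP R" by (unfold_locales)
  have cr: "cring (rees_algebra R E)"
  proof (rule cring.intro[OF S.ring_axioms])
    show "comm_monoid (rees_algebra R E)"
      by (rule S.monoid_comm_monoidI) (auto simp: rees_simps intro: P.UP_m_comm)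
  qed
  have I: "ideal (carrier (rees_algebra R B)) (rees_algebra R E)"
    by (rule rees_ideal[OF cr B])
  obtain G where G: "G \<subseteq> carrier (rees_algebra R E)" "finite G"
      "carrier (rees_algebra R B) = genideal (rees_algebra R E) G"
    using S.finetely_gen[OF I] by blast
  have "G \<subseteq> carrier (rees_algebra R B)" unfolding G(3) by (rule S.genideal_self[OF G(1)])
  then obtain c where c: "G \<subseteq> carrier (rees_algebra R (graded_span R E B c))"
    using finite_subset_graded_span[OF E B(1) G(2)] by blast
  note sp = graded_span_graded[OF E(1) B(1), of c]
  have "ideal (carrier (rees_algebra R (graded_span R E B c))) (rees_algebra R E)"
    by (rule rees_ideal[OF cr sp]) (use graded_span_subset[OF B(1)] B(2) in blast)
  then have "carrier (rees_algebra R B) \<subseteq> carrier (rees_algebra R (graded_span R E B c))"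
    unfolding G(3) by (rule S.genideal_minimal[OF _ c])
  then have "B n \<subseteq> graded_span R E B c n" for n
    by (rule rees_subset_imp_subset[OF graded_idealsD(1)[OF B(1)] graded_idealsD(1)[OF sp]])
  then show ?thesis by blast
qed

text \<open>
  The same bound for \<open>\<Oplus>\<^sub>n B\<^sub>n t\<^sup>n\<close> as a finite module over a smaller Rees algebra; here
  \<open>\<Oplus>\<^sub>n B\<^sub>n t\<^sup>n\<close> need not lie inside \<open>\<Oplus>\<^sub>n E\<^sub>n t\<^sup>n\<close>.
\<close>
lemma fin_gen_rees_bounded_span:
  assumes fg: "fin_gen_module (rees_algebra R E) (ring_as_module (rees_algebra R B))"
    and E: "graded_ideals R E E" "E 0 = carrier R" and B: "graded_ideals R E B"
  shows "\<exists>c. \<forall>n. B n \<subseteq> graded_span R E B c n"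
proof -
  let ?M = "ring_as_module (rees_algebra R B)"
  interpret M: module "rees_algebra R E" ?M using fg unfolding fin_gen_module_def by blast
  have M_simps: "carrier ?M = carrier (rees_algebra R B)" "add ?M = add (UP R)"
    "smult ?M = mult (UP R)"
    by (simp_all add: ring_as_module_def rees_simps(2,3))
  obtain G where G: "finite G" "G \<subseteq> carrier (rees_algebra R B)"
      "\<And>N. submodule N (rees_algebra R E) ?M \<Longrightarrow> G \<subseteq> N \<Longrightarrow> N = carrier ?M"
    using fg unfolding fin_gen_module_def M_simps by blast
  obtain c where c: "G \<subseteq> carrier (rees_algebra R (graded_span R E B c))"
    using finite_subset_graded_span[OF E B G(1,2)] by blast
  note sp = graded_span_graded[OF E(1) B, of c]
  have "submodule (carrier (rees_algebra R (graded_span R E B c))) (rees_algebra R E) ?M"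
  proof (rule M.submodule_closedI)
    show "carrier (rees_algebra R (graded_span R E B c)) \<subseteq> carrier ?M"
      unfolding M_simps rees_simps using graded_span_subset[OF B] by blast
  qed (use rees_closed[OF sp] in \<open>auto simp: M_simps\<close>)
  then have "carrier (rees_algebra R (graded_span R E B c)) = carrier (rees_algebra R B)"
    using G(3)[OF _ c] M_simps by simp
  then have "B n \<subseteq> graded_span R E B c n" for n
    by (intro rees_subset_imp_subset[OF graded_idealsD(1)[OF B] graded_idealsD(1)[OF sp]]) simp
  then show ?thesis by blast
qed


section \<open>Stabilisation in large degrees\<close>

lemma ideal_pow_0: "ideal_pow R I 0 = carrier R"
  and ideal_pow_Suc: "ideal_pow R I (Suc n) = ideal_pow R I n \<cdot> I"
  by (simp_all add: ideal_pow_def nat_pow_def ideals_set_def)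

lemma ideal_pow_ideal:
  assumes "ideal I R"
  shows "ideal (ideal_pow R I n) R"
  by (induction n) (auto simp: ideal_pow_0 ideal_pow_Suc oneideal ideal_prod_is_ideal assms)

lemma ideal_prod_mono: "I \<subseteq> I' \<Longrightarrow> J \<subseteq> J' \<Longrightarrow> I \<cdot> J \<subseteq> I' \<cdot> J'"
proof
  show "z \<in> I' \<cdot> J'" if "z \<in> I \<cdot> J" "I \<subseteq> I'" "J \<subseteq> J'" for z
    using that(1) by (induction rule: ideal_prod.induct) (use that(2,3) in \<open>auto intro: ideal_prod.intros\<close>)
qed

lemma graded_ideals_prod:
  assumes E: "\<And>n. ideal (E n) R" and B: "\<And>n. ideal (B n) R"
    and EB: "\<And>m n. E m \<cdot> B n \<subseteq> B (m + n)"
  shows "graded_ideals R E B"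
  unfolding graded_ideals_def using B EB ideal_prod.prod[of _ _ _ _ R] by (meson subsetD)

text \<open>
  A family on which \<open>I\<close> acts with degree one is acted on by the whole Rees algebra of \<open>I\<close>.
\<close>
lemma ideal_pow_graded_action:
  assumes I: "ideal I R" and B: "\<And>n. ideal (B n) R" and IB: "\<And>n. I \<cdot> B n \<subseteq> B (Suc n)"
  shows "graded_ideals R (ideal_pow R I) B"
proof (rule graded_ideals_prod[OF ideal_pow_ideal[OF I] B])
  show "ideal_pow R I m \<cdot> B n \<subseteq> B (m + n)" for m n
  proof (induction m arbitrary: n)
    case 0
    then show ?case
      using ideal_prod_one[OF B] ideal_prod_commute[OF oneideal B] by (simp add: ideal_pow_0)
  next
    case (Suc m)
    have "ideal_pow R I (Suc m) \<cdot> B n = ideal_pow R I m \<cdot> (I \<cdot> B n)"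
      unfolding ideal_pow_Suc by (rule ideal_prod_assoc[OF ideal_pow_ideal[OF I] I B])
    also have "\<dots> \<subseteq> ideal_pow R I m \<cdot> B (Suc n)" by (rule ideal_prod_mono[OF order_refl IB])
    also have "\<dots> \<subseteq> B (m + Suc n)" by (rule Suc)
    finally show ?case by simp
  qed
qed

lemma graded_ideals_mult:
  assumes B: "graded_ideals R E B" and K: "ideal K R" and E: "\<And>n. E n \<subseteq> carrier R"
  shows "graded_ideals R E (\<lambda>n. K \<cdot> B n)"
  unfolding graded_ideals_def
proof (intro conjI allI impI)
  note iB = graded_idealsD(1)[OF B]
  show KB: "ideal (K \<cdot> B n) R" for n by (rule ideal_prod_is_ideal[OF K iB])
  fix m n e b assume e: "e \<in> E m" and b: "b \<in> K \<cdot> B n"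
  have ec: "e \<in> carrier R" using e E by blast
  have "K \<cdot> B n \<subseteq> elem_colon (K \<cdot> B (m + n)) e"
  proof (rule ideal_prod_least[OF elem_colon_ideal[OF ec KB]])
    fix k z assume kz: "k \<in> K" "z \<in> B n"
    then have c: "k \<in> carrier R" "z \<in> carrier R" using idealD(7)[OF K] idealD(7)[OF iB] by auto
    have "k \<otimes> (e \<otimes> z) \<in> K \<cdot> B (m + n)"
      using kz graded_idealsD(2)[OF B e] by (intro ideal_prod.prod)
    moreover have "k \<otimes> (e \<otimes> z) = e \<otimes> (k \<otimes> z)" using c ec by (simp add: m_lcomm)
    ultimately show "k \<otimes> z \<in> elem_colon (K \<cdot> B (m + n)) e" using c by (simp add: elem_colon_def)
  qed
  then show "e \<otimes> b \<in> K \<cdot> B (m + n)" using b by (auto simp: elem_colon_def)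
qed

lemma filtrationD:
  assumes "filtration R F"
  shows "ideal (F n) R" "F 0 = carrier R" "F (Suc n) \<subseteq> F n" "F m \<cdot> F n \<subseteq> F (m + n)"
    "graded_ideals R F F" "m \<le> n \<Longrightarrow> F n \<subseteq> F m"
proof -
  show i: "ideal (F n) R" and "F 0 = carrier R" and s: "F (Suc n) \<subseteq> F n"
    and p: "F m \<cdot> F n \<subseteq> F (m + n)" for m n
    using assms unfolding filtration_def by blast+
  show "graded_ideals R F F" by (rule graded_ideals_prod[OF i i p])
  show "m \<le> n \<Longrightarrow> F n \<subseteq> F m" by (rule lift_Suc_antimono_le[of F, OF s])
qed

lemma ideal_pow_reduction:
  assumes J: "ideal J R" and I: "ideal I R" and k: "J \<cdot> ideal_pow R I k = ideal_pow R I (Suc k)"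
    and "k \<le> m"
  shows "ideal_pow R I (Suc m) = J \<cdot> ideal_pow R I m"
  using \<open>k \<le> m\<close>
proof (induction m rule: dec_induct)
  case base
  then show ?case using k by simp
next
  case (step m)
  have "ideal_pow R I (Suc (Suc m)) = (J \<cdot> ideal_pow R I m) \<cdot> I"
    using step.IH ideal_pow_Suc[of I "Suc m"] by simp
  then show ?case
    using ideal_prod_assoc[OF J ideal_pow_ideal[OF I] I] by (simp add: ideal_pow_Suc)
qed

text \<open>
  Generation in degrees \<open>j \<le> c\<close> over the Rees algebra of \<open>I\<^sub>1\<close> means that \<open>I\<^sub>n\<close> is spanned by the products
  \<open>I\<^sub>1\<^sup>n\<^sup>-\<^sup>j I\<^sub>j\<close>. For large \<open>n\<close> a factor \<open>J\<close> splits off the power of \<open>I\<^sub>1\<close> because \<open>J\<close> is a reduction.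
\<close>
lemma good_filtration_eventually_reduction:
  assumes good: "good_filtration R F" and red: "is_reduction R J (F 1)"
  shows "\<exists>N\<ge>1. \<forall>n\<ge>N. F n \<subseteq> J \<cdot> F (n - 1)"
proof -
  let ?E = "ideal_pow R (F 1)"
  have filt: "filtration R F" using good unfolding good_filtration_def noetherian_filtration_def by blast
  note F = filtrationD[OF filt]
  have fg: "fin_gen_module (rees_algebra R ?E) (ring_as_module (rees_algebra R F))"
    using good unfolding good_filtration_def by blast
  have EE: "graded_ideals R ?E ?E"
  proof (rule ideal_pow_graded_action[OF F(1) ideal_pow_ideal[OF F(1)]])
    show "F 1 \<cdot> ?E n \<subseteq> ?E (Suc n)" for n
      using ideal_prod_commute[OF F(1) ideal_pow_ideal[OF F(1)]] by (simp add: ideal_pow_Suc)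
  qed
  have EF: "graded_ideals R ?E F"
    by (rule ideal_pow_graded_action[OF F(1) F(1)]) (use F(4)[of 1] in simp)
  obtain c where c: "\<And>n. F n \<subseteq> graded_span R ?E F c n"
    using fin_gen_rees_bounded_span[OF fg EE ideal_pow_0 EF] by blast
  obtain k where J: "ideal J R" and k: "J \<cdot> ?E k = ?E (Suc k)"
    using red unfolding is_reduction_def by blast
  have "F n \<subseteq> J \<cdot> F (n - 1)" if n: "n \<ge> c + k + 1" for n
  proof -
    have "graded_span R ?E F c n \<subseteq> J \<cdot> F (n - 1)"
    proof (rule graded_span_least[OF ideal_prod_is_ideal[OF J F(1)]])
      fix j e b assume j: "j \<le> c" "j \<le> n" and e: "e \<in> ?E (n - j)" and b: "b \<in> F j"
      define m where "m = n - j - 1"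
      have m: "n - j = Suc m" "k \<le> m" "m + j = n - 1" using n j unfolding m_def by auto
      have "e \<in> J \<cdot> ?E m" using e ideal_pow_reduction[OF J F(1) k m(2)] m(1) by simp
      then have "e \<otimes> b \<in> (J \<cdot> ?E m) \<cdot> F j" using b by (rule ideal_prod.prod)
      also have "\<dots> = J \<cdot> (?E m \<cdot> F j)" by (rule ideal_prod_assoc[OF J ideal_pow_ideal[OF F(1)] F(1)])
      also have "\<dots> \<subseteq> J \<cdot> F (n - 1)"
      proof (rule ideal_prod_mono[OF order_refl])
        show "?E m \<cdot> F j \<subseteq> F (n - 1)"
          by (rule ideal_prod_least[OF F(1)]) (use graded_idealsD(2)[OF EF, of _ m _ j] m(3) in simp)
      qed
      finally show "e \<otimes> b \<in> J \<cdot> F (n - 1)" .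
    qed
    then show ?thesis using c by blast
  qed
  then show ?thesis by (intro exI[of _ "c + k + 1"]) auto
qed

lemma colon_ideal:
  assumes "ideal A R" "J \<subseteq> carrier R"
  shows "ideal (colon R A J) R"
proof (rule ideal_subset_closedI)
  note D = idealD[OF assms(1)]
  show "colon R A J \<subseteq> carrier R" by (auto simp: colon_def)
  show "\<zero> \<in> colon R A J" using assms(2) D(2) by (auto simp: colon_def)
  show "a \<oplus> b \<in> colon R A J" if "a \<in> colon R A J" "b \<in> colon R A J" for a b
    using that assms(2) D(3) by (auto simp: colon_def l_distr subset_eq)
  show "r \<otimes> a \<in> colon R A J" if "a \<in> colon R A J" "r \<in> carrier R" for a r
    using that assms(2) D(4) by (auto simp: colon_def m_assoc subset_eq)
qed

text \<open>
  Let \<open>A\<^sub>n = K I\<^sub>n\<close>. The bounded generation of the ideal with components \<open>A\<^sub>n \<inter> aR\<close> is an Artin--Rees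
  statement: \<open>A\<^sub>n \<inter> aR \<subseteq> a I\<^sub>n\<^sub>-\<^sub>c\<close>, hence \<open>(A\<^sub>n : J) \<subseteq> I\<^sub>n\<^sub>-\<^sub>c\<close> as \<open>a\<close> is a nonzerodivisor in \<open>J\<close>. So the
  colon ideals, shifted by \<open>c\<close>, are themselves the components of an ideal of the Rees algebra, and
  that ideal is generated in degrees at most some \<open>d\<close>. In large degrees every element is a combination of
  generators with coefficients in \<open>I\<^sub>i\<close>, where \<open>i\<close> is large enough for \<open>I\<^sub>i = J I\<^sub>i\<^sub>-\<^sub>1\<close>. The factor from \<open>J\<close>
  carries the generator into some \<open>A\<^sub>k\<close>, and the whole product lies in \<open>A\<^sub>n\<^sub>-\<^sub>1\<close>.
\<close>
lemma colon_eventually_shift: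
  assumes noeth: "noetherian_filtration R F"
    and J: "ideal J R" "J \<subseteq> F 1" and K: "ideal K R"
    and a: "a \<in> J" and nz: "\<And>r. r \<in> carrier R \<Longrightarrow> r \<otimes> a = \<zero> \<Longrightarrow> r = \<zero>"
    and N1: "N1 \<ge> 1" "\<And>n. n \<ge> N1 \<Longrightarrow> F n \<subseteq> J \<cdot> F (n - 1)"
  shows "\<exists>N. \<forall>n\<ge>N. colon R (K \<cdot> F n) J = K \<cdot> F (n - 1)"
proof -
  define A where "A n = K \<cdot> F n" for n
  have filt: "filtration R F" and nr: "noetherian_ring (rees_algebra R F)"
    using noeth unfolding noetherian_filtration_def by auto
  note F = filtrationD[OF filt]
  have FC: "F n \<subseteq> carrier R" for n by (rule idealD(1)[OF F(1)])
  have A: "graded_ideals R F A" unfolding A_def by (rule graded_ideals_mult[OF F(5) K FC])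
  note iA = graded_idealsD(1)[OF A]
  have A_F: "A n \<subseteq> F n" for n unfolding A_def using ideal_prod_inter[OF K F(1)] by blast
  have JC: "J \<subseteq> carrier R" by (rule idealD(1)[OF J(1)])
  have ac: "a \<in> carrier R" using a JC by blast
  have cancel: "u = v" if "u \<in> carrier R" "v \<in> carrier R" "a \<otimes> u = a \<otimes> v" for u v
  proof -
    have "(u \<ominus> v) \<otimes> a = a \<otimes> u \<ominus> a \<otimes> v" using that(1,2) ac by algebra
    then have "(u \<ominus> v) \<otimes> a = \<zero>" using that ac by (simp add: r_neg a_minus_def)
    then have "u \<ominus> v = \<zero>" using nz that by simp
    then show ?thesis using that by (simp add: r_right_minus_eq)
  qed
  \<comment> \<open>\<open>aF n\<close> is the ideal \<open>a I\<^sub>n\<close>; as \<open>I\<^sub>0 = R\<close>, \<open>aF 0\<close> is the principal ideal \<open>aR\<close>\<close>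
  define aF where "aF n = mult_plus a (F n) {\<zero>}" for n
  have iaF: "ideal (aF n) R" for n unfolding aF_def by (rule mult_plus_ideal[OF ac F(1) zeroideal])
  have aFI: "a \<otimes> w \<in> aF n" if "w \<in> F n" for w n
    unfolding aF_def by (rule mult_plusI[OF that]) (use ac subsetD[OF FC that] in auto)
  have aFE: "\<exists>w\<in>F n. z = a \<otimes> w" if "z \<in> aF n" for z n
  proof -
    obtain l b where "z = a \<otimes> l \<oplus> b" "l \<in> F n" "b \<in> {\<zero>}" "l \<in> carrier R" "b \<in> carrier R"
      by (rule mult_plusE[OF \<open>z \<in> aF n\<close>[unfolded aF_def] F(1) zeroideal])
    then show ?thesis using ac by auto
  qed
  define B where "B n = A n \<inter> aF 0" for n
  have B: "graded_ideals R F B"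
    unfolding graded_ideals_def
  proof (intro conjI allI impI)
    show "ideal (B n) R" for n unfolding B_def by (rule i_intersect[OF iA iaF])
    show "e \<otimes> b \<in> B (m + n)" if "e \<in> F m" "b \<in> B n" for e b m n
      using that graded_idealsD(2)[OF A] idealD(4)[OF iaF] FC unfolding B_def by blast
  qed
  obtain c where c: "\<And>n. B n \<subseteq> graded_span R F B c n"
    using noetherian_rees_bounded_span[OF nr F(5) F(2) B] A_F unfolding B_def by blast
  have B_aF: "B n \<subseteq> aF (n - c)" for n
  proof -
    have "graded_span R F B c n \<subseteq> aF (n - c)"
    proof (rule graded_span_least[OF iaF])
      fix j e b assume j: "j \<le> c" "j \<le> n" and e: "e \<in> F (n - j)" and b: "b \<in> B j"
      have ec: "e \<in> carrier R" using e FC by blast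
      obtain w where w: "w \<in> carrier R" "b = a \<otimes> w" using aFE[of b 0] b F(2) unfolding B_def by blast
      have "F (n - j) \<subseteq> F (n - c)" using j by (intro F(6)) simp
      then have "e \<otimes> w \<in> F (n - c)" using e w idealD(5)[OF F(1)] by blast
      then have "a \<otimes> (e \<otimes> w) \<in> aF (n - c)" by (rule aFI)
      moreover have "a \<otimes> (e \<otimes> w) = e \<otimes> b" using ec w ac by (simp add: m_lcomm)
      ultimately show "e \<otimes> b \<in> aF (n - c)" by simp
    qed
    then show ?thesis using c by blast
  qed
  have colon_F: "colon R (A n) J \<subseteq> F (n - c)" for n
  proof
    fix r assume "r \<in> colon R (A n) J"
    then have r: "r \<in> carrier R" "r \<otimes> a \<in> A n" using a by (auto simp: colon_def)
    then have "a \<otimes> r \<in> B n" unfolding B_def using aFI[of r 0] F(2) ac by (simp add: m_comm)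
    then obtain w where w: "w \<in> F (n - c)" "a \<otimes> r = a \<otimes> w" using B_aF aFE by blast
    then have "r = w" using cancel r FC by blast
    then show "r \<in> F (n - c)" using w by simp
  qed
  \<comment> \<open>for \<open>n = m + c\<close> the intersection with \<open>F m\<close> loses nothing, by the previous step\<close>
  define D where "D m = F m \<inter> colon R (A (m + c)) J" for m
  have D: "graded_ideals R F D"
    unfolding graded_ideals_def
  proof (intro conjI allI impI)
    show "ideal (D n) R" for n
      unfolding D_def by (rule i_intersect[OF F(1) colon_ideal[OF iA JC]])
    fix m n e b assume e: "e \<in> F m" and b: "b \<in> D n"
    have ec: "e \<in> carrier R" using e FC by blast
    have bc: "b \<in> carrier R" and bF: "b \<in> F n" using b by (auto simp: D_def colon_def)
    have "(e \<otimes> b) \<otimes> j \<in> A (m + n + c)" if j: "j \<in> J" for j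
    proof -
      have "b \<otimes> j \<in> A (n + c)" using b j by (auto simp: D_def colon_def)
      then have "e \<otimes> (b \<otimes> j) \<in> A (m + (n + c))" by (rule graded_idealsD(2)[OF A e])
      then show ?thesis using ec bc j JC by (simp add: m_assoc add.assoc subset_eq)
    qed
    then show "e \<otimes> b \<in> D (m + n)"
      using graded_idealsD(2)[OF F(5) e bF] ec bc by (simp add: D_def colon_def)
  qed
  obtain d where d: "\<And>n. D n \<subseteq> graded_span R F D d n"
    using noetherian_rees_bounded_span[OF nr F(5) F(2) D] unfolding D_def by blast
  have D_A: "D m \<subseteq> A (m + c - 1)" if m: "m \<ge> d + N1" for m
  proof -
    have "graded_span R F D d m \<subseteq> A (m + c - 1)"
    proof (rule graded_span_least[OF iA])
      fix j e b assume j: "j \<le> d" "j \<le> m" and e: "e \<in> F (m - j)" and b: "b \<in> D j"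
      have bc: "b \<in> carrier R" using b by (auto simp: D_def colon_def)
      have mj: "m - j \<ge> N1" using m j by simp
      have eq: "(m - j - 1) + (j + c) = m + c - 1" using mj N1(1) j by simp
      \<comment> \<open>\<open>e\<close> is a sum of products \<open>u v\<close> with \<open>u \<in> J\<close>, and \<open>b u \<in> A\<^sub>j\<^sub>+\<^sub>c\<close> by definition of \<open>D\<close>\<close>
      have "J \<cdot> F (m - j - 1) \<subseteq> elem_colon (A (m + c - 1)) b"
      proof (rule ideal_prod_least[OF elem_colon_ideal[OF bc iA]])
        fix u v assume u: "u \<in> J" and v: "v \<in> F (m - j - 1)"
        have uv: "u \<in> carrier R" "v \<in> carrier R" using u v JC FC by blast+
        have "b \<otimes> u \<in> A (j + c)" using b u by (auto simp: D_def colon_def)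
        then have "v \<otimes> (b \<otimes> u) \<in> A ((m - j - 1) + (j + c))" by (rule graded_idealsD(2)[OF A v])
        then have "v \<otimes> (b \<otimes> u) \<in> A (m + c - 1)" unfolding eq .
        moreover have "v \<otimes> (b \<otimes> u) = b \<otimes> (u \<otimes> v)" using uv bc by (simp add: m_ac)
        ultimately show "u \<otimes> v \<in> elem_colon (A (m + c - 1)) b" using uv by (simp add: elem_colon_def)
      qed
      then have "b \<otimes> e \<in> A (m + c - 1)" using e N1(2)[OF mj] by (auto simp: elem_colon_def)
      moreover have "b \<otimes> e = e \<otimes> b" using bc e FC m_comm by blast
      ultimately show "e \<otimes> b \<in> A (m + c - 1)" by simp
    qed
    then show ?thesis using d by blast
  qed
  have "colon R (A n) J = A (n - 1)" if n: "n \<ge> c + d + N1" for n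
  proof
    have "colon R (A n) J \<subseteq> D (n - c)" using colon_F[of n] n unfolding D_def by simp
    also have "\<dots> \<subseteq> A (n - 1)" using D_A[of "n - c"] n by simp
    finally show "colon R (A n) J \<subseteq> A (n - 1)" .
    show "A (n - 1) \<subseteq> colon R (A n) J"
    proof
      fix r assume r: "r \<in> A (n - 1)"
      then have rc: "r \<in> carrier R" using idealD(7)[OF iA] by blast
      have "r \<otimes> j \<in> A n" if j: "j \<in> J" for j
      proof -
        have "j \<otimes> r \<in> A (1 + (n - 1))" using graded_idealsD(2)[OF A _ r] j J(2) by blast
        moreover have "1 + (n - 1) = n" using n N1(1) by simp
        ultimately show ?thesis using rc j JC m_comm[of r j] by auto
      qed
      then show "r \<in> colon R (A n) J" using rc by (simp add: colon_def)
    qed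
  qed
  then show ?thesis unfolding A_def by blast
qed

end

section \<open>Second differences and eventual polynomials\<close>

lemma quadratic_of_second_difference:
  fixes g :: "nat \<Rightarrow> rat"
  assumes "\<And>t. g (t + 2) - 2 * g (t + 1) + g t = e"
  shows "g t = g 0 + (g 1 - g 0) * of_nat t + e / 2 * (of_nat t * (of_nat t - 1))"
proof -
  let ?q = "\<lambda>t. g 0 + (g 1 - g 0) * of_nat t + e / 2 * (of_nat t * (of_nat t - 1))"
  have "g t = ?q t \<and> g (t + 1) = ?q (t + 1)"
  proof (induction t)
    case 0
    then show ?case by simp
  next
    case (Suc t)
    have "g (t + 2) = e + 2 * g (t + 1) - g t" using assms[of t] by simp
    also have "\<dots> = e + 2 * ?q (t + 1) - ?q t" using Suc by simp
    also have "\<dots> = ?q (t + 2)" by (simp add: field_simps)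
    finally show ?case using Suc by simp
  qed
  then show ?thesis by blast
qed

lemma poly_eq_if_eventually_eq:
  fixes P Q :: "rat poly"
  assumes "\<forall>\<^sub>F n in sequentially. poly P (of_nat n) = poly Q (of_nat n)"
  shows "P = Q"
proof (rule ccontr)
  assume "P \<noteq> Q"
  then have fin: "finite {x. poly (P - Q) x = 0}" by (intro poly_roots_finite) simp
  obtain N where N: "\<And>n. n \<ge> N \<Longrightarrow> poly P (of_nat n) = poly Q (of_nat n)"
    using assms unfolding eventually_sequentially by blast
  have "of_nat ` {N..} \<subseteq> {x. poly (P - Q) x = 0}" using N by auto
  then have "finite ((of_nat :: nat \<Rightarrow> rat) ` {N..})" using fin finite_subset by blast
  then have "finite {N..}" by (rule finite_imageD) (simp add: inj_on_def)
  then show False by (simp add: infinite_Ici)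
qed

text \<open>
  A function whose second difference is eventually constant is eventually a quadratic polynomial. This
  settles at once that the definite description in the Hilbert polynomial denotes and what its second
  difference is, without any appeal to Hilbert--Serre theory.
\<close>
lemma second_difference_eventual_poly:
  fixes h :: "nat \<Rightarrow> rat"
  assumes h: "\<And>n. n \<ge> N \<Longrightarrow> n \<ge> 2 \<Longrightarrow> h n - 2 * h (n - 1) + h (n - 2) = e"
  defines "P \<equiv> THE P. \<forall>\<^sub>F n in sequentially. poly P (of_nat n) = h n"
  shows "poly P x - 2 * poly P (x - 1) + poly P (x - 2) = e"
proof -
  define g where "g t = h (N + t)" for t
  have g: "g t = g 0 + (g 1 - g 0) * of_nat t + e / 2 * (of_nat t * (of_nat t - 1))" for t
  proof (rule quadratic_of_second_difference)
    show "g (t + 2) - 2 * g (t + 1) + g t = e" for t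
      using h[of "N + t + 2"] by (simp add: g_def)
  qed
  \<comment> \<open>the Newton interpolation polynomial of \<open>h\<close> at the base point \<open>N\<close>\<close>
  define Q where "Q = pcompose [:g 0, g 1 - g 0 - e / 2, e / 2:] [:- of_nat N, 1:]"
  have Q: "poly Q y = g 0 + (g 1 - g 0) * (y - of_nat N) + e / 2 * ((y - of_nat N) * (y - of_nat N - 1))" for y
    by (simp add: Q_def poly_pcompose field_simps)
  have "poly Q (of_nat n) = h n" if "n \<ge> N" for n
    using g[of "n - N"] that by (simp add: Q g_def of_nat_diff)
  then have ev: "\<forall>\<^sub>F n in sequentially. poly Q (of_nat n) = h n"
    unfolding eventually_sequentially by blast
  have "P = Q"
    unfolding P_def
  proof (rule the_equality[where P = "\<lambda>P. \<forall>\<^sub>F n in sequentially. poly P (of_nat n) = h n", OF ev])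
    fix P' assume "\<forall>\<^sub>F n in sequentially. poly P' (of_nat n) = h n"
    with ev have "\<forall>\<^sub>F n in sequentially. poly P' (of_nat n) = poly Q (of_nat n)"
      by eventually_elim simp
    then show "P' = Q" by (rule poly_eq_if_eventually_eq)
  qed
  show ?thesis unfolding \<open>P = Q\<close> Q by (simp add: field_simps)
qed

lemma back_diff_twice: "(back_diff ^^ 2) f n = f n - 2 * f (n - 1) + f (n - 2)"
  by (simp add: numeral_2_eq_2 back_diff_def)

context cring
begin

section \<open>The second difference of the Hilbert function\<close>

text \<open>
  Divisibility form of the first two members of a regular sequence, which is what the syzygy computation
  works with.
\<close>
lemma exists_regular_pair:
  assumes "depth R \<mm> \<ge> 2"
  obtains a b where "a \<in> \<mm>" "b \<in> \<mm>" "a \<in> carrier R" "b \<in> carrier R"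
    "\<And>r. r \<in> carrier R \<Longrightarrow> r \<otimes> a = \<zero> \<Longrightarrow> r = \<zero>"
    "\<And>r s. r \<in> carrier R \<Longrightarrow> s \<in> carrier R \<Longrightarrow> r \<otimes> b = s \<otimes> a \<Longrightarrow> \<exists>t\<in>carrier R. r = t \<otimes> a"
proof -
  have "\<exists>xs. regular_sequence R xs \<and> set xs \<subseteq> \<mm> \<and> length xs \<ge> 2"
  proof (rule ccontr)
    assume "\<not> ?thesis"
    then have "depth R \<mm> \<le> enat 1"
      unfolding depth_def by (intro Sup_least) force
    then have "2 \<le> enat 1" using assms by (rule order_trans[rotated])
    then show False by (simp add: numeral_eq_enat)
  qed
  then obtain xs where xs: "regular_sequence R xs" "set xs \<subseteq> \<mm>" "length xs \<ge> 2" by blast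
  obtain a b ys where ab: "xs = a # b # ys"
    using xs(3) by (auto simp: numeral_2_eq_2 Suc_le_length_iff)
  then have mem: "a \<in> set xs" "b \<in> set xs" by auto
  have carr: "a \<in> carrier R" "b \<in> carrier R"
    using mem xs(1) unfolding regular_sequence_def by auto
  have I0: "Idl {} = {\<zero>}"
    using genideal_minimal[OF zeroideal, of "{}"] idealD(2)[OF genideal_ideal[of "{}"]] by auto
  have I1: "z \<in> Idl {a} \<longleftrightarrow> (\<exists>t\<in>carrier R. z = t \<otimes> a)" for z
    using cgenideal_eq_genideal[OF carr(1)] by (auto simp: cgenideal_def)
  have reg: "r \<in> Idl (set (take i xs))"
    if "i < length xs" "r \<in> carrier R" "r \<otimes> xs ! i \<in> Idl (set (take i xs))" for i r
    using xs(1) that unfolding regular_sequence_def by blast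
  have 1: "r = \<zero>" if "r \<in> carrier R" "r \<otimes> a = \<zero>" for r
    using reg[of 0 r] that I0 by (simp add: ab)
  have 2: "\<exists>t\<in>carrier R. r = t \<otimes> a"
    if "r \<in> carrier R" "s \<in> carrier R" "r \<otimes> b = s \<otimes> a" for r s
    using reg[of 1 r] that I1 by (auto simp: ab)
  show ?thesis by (rule that[of a b]) (use mem xs(2) carr 1 2 in auto)
qed

lemma radical_ideal_prod:
  assumes "ideal I R" "ideal J R" "\<mm> \<subseteq> radical R I" "\<mm> \<subseteq> radical R J"
  shows "\<mm> \<subseteq> radical R (I \<cdot> J)"
proof
  fix r assume "r \<in> \<mm>"
  then obtain i j :: nat where ij: "r \<in> carrier R" "r [^] i \<in> I" "r [^] j \<in> J"
    using assms(3,4) unfolding radical_def by blast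
  then have "r [^] (i + j) \<in> I \<cdot> J"
    using ideal_prod.prod[OF ij(2,3), of R] by (simp add: nat_pow_mult)
  then show "r \<in> radical R (I \<cdot> J)" using ij(1) unfolding radical_def by blast
qed

lemma radical_mono: "I \<subseteq> J \<Longrightarrow> radical R I \<subseteq> radical R J"
  unfolding radical_def by blast

lemma radical_ideal_pow:
  assumes "ideal I R" "\<mm> \<subseteq> radical R I" "\<mm> \<subseteq> carrier R"
  shows "\<mm> \<subseteq> radical R (ideal_pow R I n)"
proof (induction n)
  case 0
  then show ?case using assms(3) by (auto simp: radical_def ideal_pow_0)
next
  case (Suc n)
  then show ?case
    unfolding ideal_pow_Suc by (rule radical_ideal_prod[OF ideal_pow_ideal[OF assms(1)] assms(1) _ assms(2)])
qed

end

theorem lemma3p1: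
  fixes R :: "('a, 'b) ring_scheme" (structure)
    and \<mm> K J :: "'a set"
    and F :: "nat \<Rightarrow> 'a set"
    and x y :: 'a
    and n :: nat
  assumes CM: "cohen_macaulay_local_ring R \<mm>"
    and dim: "krull_dim R = 2"
    and inf: "infinite (carrier (R Quot \<mm>))"
    and hilb: "hilbert_filtration R \<mm> F"
    and K: "ideal K R" "F 1 \<subseteq> K" "\<And>k. F (Suc k) \<subseteq> K \<cdot> F k"
    and gens: "x \<in> carrier R" "y \<in> carrier R" "J = Idl {x, y}"
    and red: "is_minimal_reduction R J (F 1)"
    and n: "n \<ge> 2"
  shows "(back_diff ^^ 2)
           (\<lambda>k. poly (hilbert_poly R K F) (of_nat k) - of_nat (hilbert_fun R K F k)) n
         = of_nat (length_quot R (K \<cdot> F n) (K \<cdot> J \<cdot> F (n - 1)))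
           - of_nat (length_quot R (colon R (K \<cdot> F (n - 1)) J) (K \<cdot> F (n - 2)))"
proof -
  have "cring R" and noeth: "noetherian_ring R" and max: "maximalideal \<mm> R"
    using CM unfolding cohen_macaulay_local_ring_def noetherian_local_ring_def by auto
  then interpret cring R by blast
  have depth: "depth R \<mm> \<ge> 2" using CM dim unfolding cohen_macaulay_local_ring_def by simp
  have mC: "\<mm> \<subseteq> carrier R"
    by (rule idealD(1)[OF maximalideal.axioms(1)[OF max]])
  have good: "good_filtration R F" and rad: "\<mm> \<subseteq> radical R (F 1)"
    using hilb unfolding hilbert_filtration_def by auto
  have nf: "noetherian_filtration R F" using good unfolding good_filtration_def by blast
  then have filt: "filtration R F" unfolding noetherian_filtration_def by blast
  note F = filtrationD[OF filt]
  have redn: "is_reduction R J (F 1)" using red unfolding is_minimal_reduction_def by blast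
  then obtain k where J: "ideal J R" "J \<subseteq> F 1"
    and k: "J \<cdot> ideal_pow R (F 1) k = ideal_pow R (F 1) (Suc k)"
    unfolding is_reduction_def by blast
  have iF1: "ideal (F 1) R" by (rule F(1))
  have rad_J: "\<mm> \<subseteq> radical R J"
  proof -
    have "\<mm> \<subseteq> radical R (ideal_pow R (F 1) (Suc k))" by (rule radical_ideal_pow[OF iF1 rad mC])
    also have "\<dots> \<subseteq> radical R J"
      unfolding k[symmetric] using ideal_prod_inter[OF J(1) ideal_pow_ideal[OF iF1]]
      by (intro radical_mono) blast
    finally show ?thesis .
  qed
  have rad_K: "\<mm> \<subseteq> radical R K" using rad radical_mono[OF K(2)] by blast
  have rad_F: "\<mm> \<subseteq> radical R (F m)" for m
  proof (induction m)
    case 0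
    then show ?case using mC F(2) by (auto simp: radical_def)
  next
    case (Suc m)
    have "\<mm> \<subseteq> radical R (F 1 \<cdot> F m)" by (rule radical_ideal_prod[OF iF1 F(1) rad Suc])
    also have "\<dots> \<subseteq> radical R (F (Suc m))" using F(4)[of 1 m] by (intro radical_mono) simp
    finally show ?case .
  qed
  obtain a b where ab: "a \<in> \<mm>" "b \<in> \<mm>" "a \<in> carrier R" "b \<in> carrier R"
    and nz: "\<And>r. r \<in> carrier R \<Longrightarrow> r \<otimes> a = \<zero> \<Longrightarrow> r = \<zero>"
    and reg: "\<And>r s. r \<in> carrier R \<Longrightarrow> s \<in> carrier R \<Longrightarrow> r \<otimes> b = s \<otimes> a \<Longrightarrow> \<exists>t\<in>carrier R. r = t \<otimes> a"
    by (rule exists_regular_pair[OF depth]) (rule that)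
  obtain p q :: nat where pq: "a [^] p \<in> J" "b [^] q \<in> J"
    using ab(1,2) rad_J unfolding radical_def by blast
  have nz': "r = \<zero>" if "r \<in> carrier R" "r \<otimes> a [^] p = \<zero>" for r
    by (rule nonzerodivisor_power[OF ab(3) nz that])
  have syz: "trivial_syzygies x y"
  proof (rule trivial_syzygies_of_regular_sequence[OF gens(1,2)])
    show "a [^] p \<in> Idl {x, y}" "b [^] q \<in> Idl {x, y}" using pq gens(3) by auto
    show "\<exists>t\<in>carrier R. r = t \<otimes> a [^] p"
      if "r \<in> carrier R" "s \<in> carrier R" "r \<otimes> b [^] q = s \<otimes> a [^] p" for r s
      by (rule regular_mod_power[OF ab(3,4) nz reg that])
  qed (rule nz')
  define A where "A m = K \<cdot> F m" for m
  define H where "H m = length_quot R (carrier R) (A m)" for m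
  define l1 where "l1 m = length_quot R (A m) (J \<cdot> A (m - 1))" for m
  define l2 where "l2 m = length_quot R (colon R (A (m - 1)) J) (A (m - 2))" for m
  define e where "e = length_quot R (carrier R) J"
  have iA: "ideal (A m) R" for m unfolding A_def by (rule ideal_prod_is_ideal[OF K(1) F(1)])
  have rad_A: "\<mm> \<subseteq> radical R (A m)" for m
    unfolding A_def by (rule radical_ideal_prod[OF K(1) F(1) rad_K rad_F])
  have iJA: "ideal (J \<cdot> A m) R" for m by (rule ideal_prod_is_ideal[OF J(1) iA])
  have fin_A: "fin_length (carrier R) (A m)" and fin_JA: "fin_length (carrier R) (J \<cdot> A m)" for m
    using fin_length_radical[OF noeth max iA rad_A]
      fin_length_radical[OF noeth max iJA radical_ideal_prod[OF J(1) iA rad_J rad_A]] by auto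
  have gA: "graded_ideals R F A"
    unfolding A_def by (rule graded_ideals_mult[OF F(5) K(1) idealD(1)[OF F(1)]])
  have JA: "J \<cdot> A m \<subseteq> A (Suc m)" for m
    by (rule ideal_prod_least[OF iA]) (use graded_idealsD(2)[OF gA, of _ 1 _ m] J(2) in auto)
  have A_colon: "A m \<subseteq> colon R (A (Suc m)) J" for m
  proof
    fix r assume r: "r \<in> A m"
    have "r \<otimes> j \<in> A (Suc m)" if "j \<in> J" for j
      using JA[of m] ideal_prod.prod[OF that r, of R] m_comm[OF idealD(7)[OF iA r] idealD(7)[OF J(1) that]]
      by auto
    then show "r \<in> colon R (A (Suc m)) J" using idealD(7)[OF iA r] by (simp add: colon_def)
  qed
  have icolon: "ideal (colon R (A m) J) R" for m by (rule colon_ideal[OF iA idealD(1)[OF J(1)]])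
  have KJF: "K \<cdot> J \<cdot> F m = J \<cdot> A m" for m
    unfolding A_def using ideal_prod_assoc[OF J(1) K(1) F(1)] ideal_prod_commute[OF K(1) J(1)] by simp
  \<comment> \<open>the identity for \<open>\<Delta>\<^sup>2 H\<close>, arranged so that it makes sense in the natural numbers\<close>
  have key: "H m + l1 m + H (m - 2) = e + 2 * H (m - 1) + l2 m" if m: "m \<ge> 2" for m
  proof -
    have S: "Suc (m - 1) = m" "Suc (m - 2) = m - 1" using m by auto
    have "length_quot R (carrier R) (J \<cdot> A (m - 1)) = H m + l1 m"
      unfolding H_def l1_def
      by (rule length_quot_add[OF fin_JA iA]) (use JA[of "m - 1"] S idealD(1)[OF iA] in auto)
    moreover have "H (m - 2) = length_quot R (carrier R) (colon R (A (m - 1)) J) + l2 m"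
      unfolding H_def l2_def
      by (rule length_quot_add[OF fin_A icolon]) (use A_colon[of "m - 2"] S idealD(1)[OF icolon] in auto)
    moreover have "length_quot R (carrier R) (J \<cdot> A (m - 1))
        + length_quot R (carrier R) (colon R (A (m - 1)) J) = e + 2 * H (m - 1)"
      unfolding e_def H_def gens(3)
      by (rule length_two_gen_prod[OF gens(1,2) syz iA]) (use fin_JA gens(3) in simp)
    ultimately show ?thesis by simp
  qed
  obtain N1 where N1: "N1 \<ge> 1" "\<And>m. m \<ge> N1 \<Longrightarrow> F m \<subseteq> J \<cdot> F (m - 1)"
    using good_filtration_eventually_reduction[OF good redn] by blast
  obtain N2 where N2: "\<And>m. m \<ge> N2 \<Longrightarrow> colon R (A m) J = A (m - 1)"
    using colon_eventually_shift[OF nf J K(1) pq(1) nz' N1] unfolding A_def by blast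
  have l1_0: "l1 m = 0" if m: "m \<ge> N1" for m
  proof -
    have "A m \<subseteq> K \<cdot> (J \<cdot> F (m - 1))" unfolding A_def by (rule ideal_prod_mono[OF order_refl N1(2)[OF m]])
    then have "A m \<subseteq> J \<cdot> A (m - 1)"
      using KJF ideal_prod_assoc[OF K(1) J(1) F(1)] by simp
    moreover have "J \<cdot> A (m - 1) \<subseteq> A m" using JA[of "m - 1"] m N1(1) by simp
    ultimately have "J \<cdot> A (m - 1) = A m" by blast
    then show ?thesis unfolding l1_def using length_quot_refl[OF iA] by simp
  qed
  have l2_0: "l2 m = 0" if m: "m \<ge> N2 + 1" for m
    unfolding l2_def using N2[of "m - 1"] m length_quot_refl[OF iA] by (simp add: numeral_2_eq_2)
  have keyr: "rat_of_nat (H m) - 2 * of_nat (H (m - 1)) + of_nat (H (m - 2))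
      = of_nat e - of_nat (l1 m) + of_nat (l2 m)" if "m \<ge> 2" for m
    using arg_cong[OF key[OF that], of rat_of_nat] by simp
  have H_eq: "hilbert_fun R K F = H" by (auto simp: hilbert_fun_def H_def A_def)
  \<comment> \<open>both correction terms vanish eventually, so \<open>\<Delta>\<^sup>2 H\<close> is eventually \<open>\<lambda>(R/J)\<close>\<close>
  have "poly (hilbert_poly R K F) t - 2 * poly (hilbert_poly R K F) (t - 1)
      + poly (hilbert_poly R K F) (t - 2) = of_nat e" for t
    unfolding hilbert_poly_def H_eq
  proof (rule second_difference_eventual_poly)
    show "rat_of_nat (H m) - 2 * of_nat (H (m - 1)) + of_nat (H (m - 2)) = of_nat e"
      if "m \<ge> N1 + N2 + 1" "m \<ge> 2" for m
      using keyr[OF that(2)] l1_0[of m] l2_0[of m] that(1) by simp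
  qed
  from this[of "of_nat n"] show ?thesis
    unfolding back_diff_twice H_eq using keyr[OF n] n
    by (simp add: KJF l1_def l2_def of_nat_diff flip: A_def)
qed

end
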